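(* Let $K$ be a field of characteristic zero containing an element of multiplicative order $9$, and let \[\mathrm{M}_{27}=\langle a,b \mid a^9=b^3=1,\ bab^{-1}=a^4 \rangle\cong \mathrm{C}_9\rtimes \mathrm{C}_3 .\] Then $\beta_{\mathrm{sep}}^K(\mathrm{M}_{27})=10$.
   Context: Let $K$ be a field and $G$ a finite group with $\mathrm{char}(K)\nmid |G|$. For a finite dimensional $KG$-module $V$, $K[V]$ is the polynomial ring in the coordinate functions on $V$, on which $G$ acts by $(g\cdot f)(v)=f(g^{-1}v)$, and $K[V]^G$ is the subalgebra of $G$-invariants. A subset $S\subseteq K[V]^G$ is a separating set if whenever $v,w\in V$ have different $G$-orbits, there is $f\in S$ with $f(v)\ne f(w)$. The number $\beta_{\mathrm{sep}}(G,V)$ is the minimal positive integer $d$ such that the elements of $K[V]^G$ of degree at most $d$ form a separating set, and $\beta_{\mathrm{sep}}^K(G)$ is the supremum of $\beta_{\mathrm{sep}}(G,V)$ over all finite dimensional $KG$-modules $V$. *)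

theory Defs
  imports
    "HOL-Algebra.Group"
    "HOL-Library.Poly_Mapping"
    "HOL-Library.Extended_Nat"
    "Jordan_Normal_Form.Matrix"
begin

section \<open>Groups given by generators and relations\<close>

text \<open>
  A word is a list of letters; \<open>(x, True)\<close> stands for the generator \<open>x\<close> and
  \<open>(x, False)\<close> for its formal inverse. A pair \<open>(u, v)\<close> of words is the relation \<open>u = v\<close>.
\<close>

type_synonym 'x word = "('x \<times> bool) list"

inductive word_equiv :: "('x word \<times> 'x word) set \<Rightarrow> 'x word \<Rightarrow> 'x word \<Rightarrow> bool"
  for R :: "('x word \<times> 'x word) set"
where
  relation: "(u, v) \<in> R \<Longrightarrow> word_equiv R u v"
| cancel: "word_equiv R [(x, s), (x, \<not> s)] []"
| refl: "word_equiv R u u"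
| sym: "word_equiv R u v \<Longrightarrow> word_equiv R v u"
| trans: "word_equiv R u v \<Longrightarrow> word_equiv R v w \<Longrightarrow> word_equiv R u w"
| append: "word_equiv R u u' \<Longrightarrow> word_equiv R v v' \<Longrightarrow> word_equiv R (u @ v) (u' @ v')"

definition word_class :: "('x word \<times> 'x word) set \<Rightarrow> 'x word \<Rightarrow> 'x word set" where
  "word_class R u = {v. word_equiv R u v}"

text \<open>All elements of the type \<open>'x\<close> are generators.\<close>

definition presented_group :: "('x word \<times> 'x word) set \<Rightarrow> 'x word set monoid" where
  "presented_group R =
     \<lparr>carrier = range (word_class R),
      mult = (\<lambda>A B. {w. \<exists>u\<in>A. \<exists>v\<in>B. word_equiv R (u @ v) w}),
      one = word_class R []\<rparr>"

lemma presented_group_mult: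
  "word_class R u \<otimes>\<^bsub>presented_group R\<^esub> word_class R v = word_class R (u @ v)"
  unfolding presented_group_def word_class_def
  by (auto intro: word_equiv.refl word_equiv.append word_equiv.trans)

lemma word_equiv_inverse:
  "word_equiv R (rev (map (\<lambda>(x, s). (x, \<not> s)) u) @ u) []"
proof (induction u)
  case Nil
  show ?case by (simp add: word_equiv.refl)
next
  case (Cons l u)
  obtain x s where l: "l = (x, s)" by (cases l)
  let ?r = "rev (map (\<lambda>(x, s). (x, \<not> s)) u)"
  have "word_equiv R ([(x, \<not> s), (x, s)] @ u) ([] @ u)"
    using word_equiv.cancel[of R x "\<not> s"] by (intro word_equiv.append word_equiv.refl) simp
  then have "word_equiv R (?r @ [(x, \<not> s), (x, s)] @ u) (?r @ u)"
    by (intro word_equiv.append word_equiv.refl) simp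
  with Cons.IH show ?case unfolding l by (auto intro: word_equiv.trans)
qed

lemma presented_group_carrier: "carrier (presented_group R) = range (word_class R)"
  and presented_group_one: "\<one>\<^bsub>presented_group R\<^esub> = word_class R []"
  by (simp_all add: presented_group_def)

lemma group_presented_group: "group (presented_group R)"
proof (rule groupI)
  have cl: "word_class R u = word_class R v" if "word_equiv R u v" for u v
    using that unfolding word_class_def by (auto intro: word_equiv.trans word_equiv.sym)
  show "\<exists>y\<in>carrier (presented_group R). y \<otimes>\<^bsub>presented_group R\<^esub> x = \<one>\<^bsub>presented_group R\<^esub>"
    if "x \<in> carrier (presented_group R)" for x
    using that cl[OF word_equiv_inverse] unfolding presented_group_carrier presented_group_one
    by (metis (no_types, lifting) imageE presented_group_mult rangeI)
qed (auto simp: presented_group_carrier presented_group_one presented_group_mult)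

datatype two_gens = gen_a | gen_b

definition M27 :: "two_gens word set monoid" where
  "M27 =
     (let a = (gen_a, True); b = (gen_b, True); b' = (gen_b, False) in
      presented_group
        {(replicate 9 a, []),
         (replicate 3 b, []),
         ([b, a, b'], replicate 4 a)})"


section \<open>Polynomials in the coordinate functions\<close>

text \<open>
  A polynomial is a finitely supported map from monomials to coefficients, a monomial being
  a finitely supported map from the indices of the variables to exponents.
\<close>

type_synonym 'k mpoly = "(nat \<Rightarrow>\<^sub>0 nat) \<Rightarrow>\<^sub>0 'k"

definition const :: "'k \<Rightarrow> 'k::field mpoly" where
  "const c = Poly_Mapping.single 0 c"

definition var :: "nat \<Rightarrow> 'k::field mpoly" where
  "var i = Poly_Mapping.single (Poly_Mapping.single i 1) 1"

definition eval :: "'k vec \<Rightarrow> 'k::field mpoly \<Rightarrow> 'k" where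
  "eval v f =
     (\<Sum>m\<in>Poly_Mapping.keys f.
        Poly_Mapping.lookup f m *
        (\<Prod>i\<in>Poly_Mapping.keys m. (v $ i) ^ Poly_Mapping.lookup m i))"

definition subst :: "(nat \<Rightarrow> 'k mpoly) \<Rightarrow> 'k::field mpoly \<Rightarrow> 'k mpoly" where
  "subst \<sigma> f =
     (\<Sum>m\<in>Poly_Mapping.keys f.
        const (Poly_Mapping.lookup f m) *
        (\<Prod>i\<in>Poly_Mapping.keys m. \<sigma> i ^ Poly_Mapping.lookup m i))"

definition polys :: "nat \<Rightarrow> 'k::field mpoly set" where
  "polys n = {f. \<forall>m\<in>Poly_Mapping.keys f. Poly_Mapping.keys m \<subseteq> {..<n}}"

definition degree_at_most :: "nat \<Rightarrow> 'k::field mpoly \<Rightarrow> bool" where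
  "degree_at_most d f \<longleftrightarrow>
     (\<forall>m\<in>Poly_Mapping.keys f. (\<Sum>i\<in>Poly_Mapping.keys m. Poly_Mapping.lookup m i) \<le> d)"


section \<open>Invariants and separating sets\<close>

text \<open>
  A finite dimensional module over the group algebra is given, after the choice of a basis, by a
  homomorphism \<open>\<rho>\<close> from \<open>G\<close> to the group of invertible \<open>n \<times> n\<close> matrices, acting on column vectors.
\<close>

definition is_rep :: "('g, 'm) monoid_scheme \<Rightarrow> nat \<Rightarrow> ('g \<Rightarrow> 'k::field mat) \<Rightarrow> bool" where
  "is_rep G n \<rho> \<longleftrightarrow> \<rho> \<in> hom G (units_of (ring_mat TYPE('k) n ()))"

definition orbit :: "('g, 'm) monoid_scheme \<Rightarrow> ('g \<Rightarrow> 'k::field mat) \<Rightarrow> 'k vec \<Rightarrow> 'k vec set" where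
  "orbit G \<rho> v = {\<rho> g *\<^sub>v v |g. g \<in> carrier G}"

text \<open>
  \<open>(g \<cdot> f)(v) = f (g\<^sup>-\<^sup>1 v)\<close>, that is, the \<open>i\<close>-th variable is replaced by the \<open>i\<close>-th coordinate of
  \<open>g\<^sup>-\<^sup>1 v\<close>, a linear form in the coordinates of \<open>v\<close>.
\<close>

definition act ::
  "('g, 'm) monoid_scheme \<Rightarrow> nat \<Rightarrow> ('g \<Rightarrow> 'k::field mat) \<Rightarrow> 'g \<Rightarrow> 'k mpoly \<Rightarrow> 'k mpoly" where
  "act G n \<rho> g f = subst (\<lambda>i. \<Sum>j<n. const (\<rho> (inv\<^bsub>G\<^esub> g) $$ (i, j)) * var j) f"

definition invariants ::
  "('g, 'm) monoid_scheme \<Rightarrow> nat \<Rightarrow> ('g \<Rightarrow> 'k::field mat) \<Rightarrow> 'k mpoly set" where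
  "invariants G n \<rho> = {f \<in> polys n. \<forall>g\<in>carrier G. act G n \<rho> g f = f}"

definition separating_set ::
  "('g, 'm) monoid_scheme \<Rightarrow> nat \<Rightarrow> ('g \<Rightarrow> 'k::field mat) \<Rightarrow> 'k mpoly set \<Rightarrow> bool" where
  "separating_set G n \<rho> S \<longleftrightarrow>
     S \<subseteq> invariants G n \<rho> \<and>
     (\<forall>v\<in>carrier_vec n. \<forall>w\<in>carrier_vec n.
        orbit G \<rho> v \<noteq> orbit G \<rho> w \<longrightarrow> (\<exists>f\<in>S. eval v f \<noteq> eval w f))"

text \<open>
  In \<^typ>\<open>enat\<close> the infimum of a nonempty set is its minimum, and that of the empty set is \<open>\<infinity>\<close>.
\<close>

definition beta_sep_rep ::
  "('g, 'm) monoid_scheme \<Rightarrow> nat \<Rightarrow> ('g \<Rightarrow> 'k::field mat) \<Rightarrow> enat" where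
  "beta_sep_rep G n \<rho> =
     Inf {enat d |d. d > 0 \<and> separating_set G n \<rho> {f \<in> invariants G n \<rho>. degree_at_most d f}}"

definition beta_sep :: "'k::field itself \<Rightarrow> ('g, 'm) monoid_scheme \<Rightarrow> enat" where
  "beta_sep K G = Sup {beta_sep_rep G n \<rho> |n (\<rho> :: 'g \<Rightarrow> 'k mat). is_rep G n \<rho>}"

end

theory Submission
  imports Defs "HOL-Computational_Algebra.Polynomial"
begin

text \<open>
  Upper bound. Let \<open>\<alpha>\<close> and \<open>\<beta>\<close> be the actions of \<open>a\<close> and \<open>b\<close>, and suppose that all invariants of degree at
  most 10 agree at \<open>v\<close> and \<open>w\<close>; equivalently, \<open>f v + f (\<beta> v) + f (\<beta>\<^sup>2 v) = f w + f (\<beta> w) + f (\<beta>\<^sup>2 w)\<close> for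
  every \<open>\<alpha>\<close>-invariant polynomial \<open>f\<close> of degree at most 10. Linear forms split into weight spaces of \<open>\<alpha>\<close>; if
  \<open>t\<close> has weight 1, then \<open>t\<close>, \<open>t \<circ> \<beta>\<close>, \<open>t \<circ> \<beta>\<^sup>2\<close> have weights 1, 4, 7, and \<open>s = t\<^sup>2 (t \<circ> \<beta>\<^sup>2)\<close> is
  \<open>\<alpha>\<close>-invariant. If \<open>s\<close> is not constant on \<open>{v, \<beta> v, \<beta>\<^sup>2 v}\<close>, then comparing power sums of \<open>s\<close> and
  interpolating in \<open>s\<close> isolates one point of \<open>{v, \<beta> v, \<beta>\<^sup>2 v}\<close> and one of \<open>{w, \<beta> w, \<beta>\<^sup>2 w}\<close> at which all
  \<open>\<alpha>\<close>-invariants of degree at most 4 (or 7) agree, and these suffice to identify the \<open>\<alpha>\<close>-orbit, since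
  monomials of degree at most 3 in \<open>t\<close>, \<open>t \<circ> \<beta>\<close>, \<open>t \<circ> \<beta>\<^sup>2\<close> have all weights. If exactly one of the three
  coordinates is nonzero, the products \<open>u t\<^sup>e\<close> with \<open>e \<le> 9\<close> do. Otherwise every such \<open>t\<close> is an eigenvector for
  \<open>\<beta>\<close> at \<open>v\<close> and \<open>w\<close>, so that these points have a nontrivial stabilizer and only a residual action of
  \<open>C\<^sub>3\<close> or \<open>C\<^sub>3 \<times> C\<^sub>3\<close> has to be separated.

  Lower bound. On the sum of a faithful three-dimensional representation and the character \<open>a \<mapsto> 1\<close>,
  \<open>b \<mapsto> \<omega>\<close>, where \<open>\<omega> = \<zeta>\<^sup>3\<close>, the points \<open>(1, 0, 0, 1)\<close> and \<open>(1, 0, 0, \<omega>)\<close> are separated by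
  \<open>x\<^sub>3 (x\<^sub>0\<^sup>9 + \<omega> x\<^sub>1\<^sup>9 + \<omega>\<^sup>2 x\<^sub>2\<^sup>9)\<close>, but by no invariant of degree at most 9.
\<close>

section \<open>Weights of the cyclic normal subgroup\<close>

text \<open>Newton's identities express the elementary symmetric functions of three numbers through
  their first three power sums, at the cost of dividing by 2 and by 6. Equality of the monic cubics
  encodes equality of the multisets.\<close>

lemma power_sums_3:
  fixes a b c :: "'k::field_char_0"
  assumes 1: "a + b + c = a' + b' + c'"
    and 2: "a^2 + b^2 + c^2 = a'^2 + b'^2 + c'^2"
    and 3: "a^3 + b^3 + c^3 = a'^3 + b'^3 + c'^3"
  shows "(x - a) * (x - b) * (x - c) = (x - a') * (x - b') * (x - c')"
proof -
  have "2 * (a * b + b * c + c * a) = (a + b + c)^2 - (a^2 + b^2 + c^2)" by (simp add: power2_eq_square power3_eq_cube algebra_simps)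
  also have "\<dots> = 2 * (a' * b' + b' * c' + c' * a')" unfolding 1 2 by (simp add: power2_eq_square power3_eq_cube algebra_simps)
  finally have e2: "a * b + b * c + c * a = a' * b' + b' * c' + c' * a'"
    by (subst (asm) mult_cancel_left) simp
  have "6 * (a * b * c) = (a + b + c)^3 - 3 * (a + b + c) * (a^2 + b^2 + c^2) + 2 * (a^3 + b^3 + c^3)"
    by (simp add: power2_eq_square power3_eq_cube algebra_simps)
  also have "\<dots> = 6 * (a' * b' * c')" unfolding 1 2 3 by (simp add: power2_eq_square power3_eq_cube algebra_simps)
  finally have e3: "a * b * c = a' * b' * c'" by simp
  have "(x - a) * (x - b) * (x - c) = x^3 - (a + b + c) * x^2 + (a * b + b * c + c * a) * x - a * b * c"
    by (simp add: power2_eq_square power3_eq_cube algebra_simps)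
  also have "\<dots> = (x - a') * (x - b') * (x - c')" unfolding 1 e2 e3 by (simp add: power2_eq_square power3_eq_cube algebra_simps)
  finally show ?thesis .
qed

text \<open>The first n powers of \<zeta> are n different roots of X^n - 1, which has at most n
  roots, so there are no others.\<close>

lemma primitive_root_power:
  fixes \<zeta> z :: "'k::field"
  assumes "\<zeta> ^ n = 1" "\<And>m. 0 < m \<Longrightarrow> m < n \<Longrightarrow> \<zeta> ^ m \<noteq> 1" "n > 0" "z ^ n = 1"
  shows "\<exists>i<n. z = \<zeta> ^ i"
proof -
  have nz: "\<zeta> \<noteq> 0" using assms(1,3) by (metis power_0_left not_gr_zero zero_neq_one)
  have inj: "inj_on (\<lambda>i. \<zeta> ^ i) {..<n}"
  proof (rule linorder_inj_onI)
    fix i j assume ij: "i < j" "i \<in> {..<n}" "j \<in> {..<n}"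
    have "\<zeta> ^ j = \<zeta> ^ i * \<zeta> ^ (j - i)" using ij by (simp flip: power_add)
    moreover have "\<zeta> ^ (j - i) \<noteq> 1" using ij by (intro assms(2)) auto
    ultimately show "\<zeta> ^ i \<noteq> \<zeta> ^ j" using nz by auto
  qed auto
  let ?p = "monom 1 n - 1 :: 'k poly"
  have p0: "?p \<noteq> 0"
  proof
    assume "?p = 0"
    then have "coeff ?p n = 0" by simp
    then show False using assms(3) by (simp add: coeff_1)
  qed
  have deg: "degree ?p \<le> n"
    by (rule degree_diff_le) (auto simp: degree_monom_le)
  have sub: "(\<lambda>i. \<zeta> ^ i) ` {..<n} \<subseteq> {x. poly ?p x = 0}"
    using assms(1) by (auto simp: poly_monom simp flip: power_mult) (metis mult.commute power_mult power_one)
  have fin: "finite {x. poly ?p x = 0}" by (rule poly_roots_finite[OF p0])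
  have "card {x. poly ?p x = 0} \<le> card ((\<lambda>i. \<zeta> ^ i) ` {..<n})"
    using card_poly_roots_bound[OF p0] deg card_image[OF inj] by simp
  then have "(\<lambda>i. \<zeta> ^ i) ` {..<n} = {x. poly ?p x = 0}"
    by (intro card_seteq[OF fin sub])
  then show ?thesis using assms(4) by (auto simp: poly_monom)
qed

text \<open>An abstract frame for the upper bound: \<open>P d\<close> plays the role of the
  polynomial functions of degree at most d on the points \<open>X\<close>, and all that remains of
  linearity is that \<open>P 1\<close> separates points. The root \<zeta> is a parameter so that
  every result can be reused with its inverse, which exchanges the weights 1 and 8.\<close>

locale m27_action =
  fixes X :: "'x set" and \<alpha> \<beta> :: "'x \<Rightarrow> 'x" and P :: "nat \<Rightarrow> ('x \<Rightarrow> 'k::field_char_0) set" and \<zeta> :: 'k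
  assumes \<alpha>_closed [simp]: "x \<in> X \<Longrightarrow> \<alpha> x \<in> X"
    and \<beta>_closed [simp]: "x \<in> X \<Longrightarrow> \<beta> x \<in> X"
    and \<alpha>_9: "x \<in> X \<Longrightarrow> (\<alpha> ^^ 9) x = x"
    and \<beta>_3 [simp]: "x \<in> X \<Longrightarrow> \<beta> (\<beta> (\<beta> x)) = x"
    and \<beta>_\<alpha>: "x \<in> X \<Longrightarrow> \<beta> (\<alpha> x) = (\<alpha> ^^ 4) (\<beta> x)"
    and \<zeta>_9: "\<zeta> ^ 9 = 1"
    and \<zeta>_prim: "0 < m \<Longrightarrow> m < 9 \<Longrightarrow> \<zeta> ^ m \<noteq> 1"
    and P_const: "(\<lambda>_. c) \<in> P 0"
    and P_add: "f \<in> P d \<Longrightarrow> g \<in> P d \<Longrightarrow> (\<lambda>x. f x + g x) \<in> P d"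
    and P_mult: "f \<in> P d \<Longrightarrow> g \<in> P e \<Longrightarrow> (\<lambda>x. f x * g x) \<in> P (d + e)"
    and P_mono: "f \<in> P d \<Longrightarrow> d \<le> e \<Longrightarrow> f \<in> P e"
    and P_\<alpha>: "f \<in> P d \<Longrightarrow> (\<lambda>x. f (\<alpha> x)) \<in> P d"
    and P_\<beta>: "f \<in> P d \<Longrightarrow> (\<lambda>x. f (\<beta> x)) \<in> P d"
    and P_separates: "v \<in> X \<Longrightarrow> w \<in> X \<Longrightarrow> (\<And>u. u \<in> P 1 \<Longrightarrow> u v = u w) \<Longrightarrow> v = w"
begin

lemma \<alpha>_pow_closed [simp]: "x \<in> X \<Longrightarrow> (\<alpha> ^^ i) x \<in> X"
  by (induction i) auto

lemma \<beta>_pow_closed [simp]: "x \<in> X \<Longrightarrow> (\<beta> ^^ i) x \<in> X"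
  by (induction i) auto

lemma \<zeta>_nz: "\<zeta> \<noteq> 0"
  using \<zeta>_9 by auto

lemma \<zeta>_mod: "\<zeta> ^ k = \<zeta> ^ (k mod 9)"
proof -
  have "\<zeta> ^ k = \<zeta> ^ (9 * (k div 9) + k mod 9)" by simp
  also have "\<dots> = \<zeta> ^ (k mod 9)" unfolding power_add power_mult \<zeta>_9 by simp
  finally show ?thesis .
qed

lemma \<zeta>_eq_1_iff: "\<zeta> ^ k = 1 \<longleftrightarrow> k mod 9 = 0"
proof (cases "k mod 9 = 0")
  case False
  then have "\<zeta> ^ (k mod 9) \<noteq> 1" by (intro \<zeta>_prim) auto
  with False show ?thesis by (simp flip: \<zeta>_mod)
qed (simp add: \<zeta>_mod[of k])

lemma root_9: "z ^ 9 = 1 \<Longrightarrow> \<exists>i<9. z = \<zeta> ^ i"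
  using primitive_root_power[OF \<zeta>_9 \<zeta>_prim] by simp

lemma root_3:
  assumes "z ^ 3 = 1"
  shows "\<exists>i<3. z = \<zeta> ^ (3 * i)"
proof -
  have "z ^ 9 = (z ^ 3) ^ 3" by (simp flip: power_mult)
  then have "z ^ 9 = 1" using assms by simp
  then obtain i where i: "z = \<zeta> ^ i" "i < 9" using root_9 by blast
  have "\<zeta> ^ (3 * i) = 1" using assms i by (simp add: power_mult mult.commute)
  then have "(3 * i) mod 9 = 0" using \<zeta>_eq_1_iff by blast
  then have "3 * (i div 3) = i" "i div 3 < 3" using i(2) by presburger+
  then show ?thesis by (intro exI[of _ "i div 3"]) (simp add: i(1))
qed

text \<open>Weights are natural numbers that matter only modulo 9; products simply add them, and
  \<open>wt_cast\<close> renormalizes.\<close>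

definition wt :: "nat \<Rightarrow> nat \<Rightarrow> ('x \<Rightarrow> 'k) set" where
  "wt d k = {f \<in> P d. \<forall>x\<in>X. f (\<alpha> x) = \<zeta> ^ k * f x}"

lemma wt_\<alpha>: "f \<in> wt d k \<Longrightarrow> x \<in> X \<Longrightarrow> f (\<alpha> x) = \<zeta> ^ k * f x"
  by (simp add: wt_def)

lemma wt_\<alpha>_pow: "f \<in> wt d k \<Longrightarrow> x \<in> X \<Longrightarrow> f ((\<alpha> ^^ i) x) = \<zeta> ^ (k * i) * f x"
  by (induction i) (auto simp: wt_\<alpha> power_add)

lemma wt_cong: "k mod 9 = l mod 9 \<Longrightarrow> wt d k = wt d l"
  unfolding wt_def by (metis \<zeta>_mod)

lemma wt_cast: "f \<in> wt d k \<Longrightarrow> k mod 9 = l mod 9 \<Longrightarrow> d \<le> e \<Longrightarrow> f \<in> wt e l"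
  using P_mono[of f d e] wt_cong[of k l e] unfolding wt_def by blast

lemma wt_const: "(\<lambda>_. c) \<in> wt 0 0"
  by (simp add: wt_def P_const)

lemma wt_add: "f \<in> wt d k \<Longrightarrow> g \<in> wt d k \<Longrightarrow> (\<lambda>x. f x + g x) \<in> wt d k"
  by (auto simp: wt_def P_add algebra_simps)

lemma wt_mult: "f \<in> wt d k \<Longrightarrow> g \<in> wt e l \<Longrightarrow> (\<lambda>x. f x * g x) \<in> wt (d + e) (k + l)"
  by (auto simp: wt_def P_mult power_add)

lemma wt_power: "f \<in> wt d k \<Longrightarrow> (\<lambda>x. f x ^ n) \<in> wt (n * d) (n * k)"
  by (induction n) (auto intro: wt_const wt_mult)

lemma wt_diff_const: "f \<in> wt d 0 \<Longrightarrow> (\<lambda>x. f x - c) \<in> wt d 0"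
  using wt_add[of f d 0 "\<lambda>_. - c"] wt_cast[OF wt_const[of "- c"], of 0 d] by simp

text \<open>By the relation \<beta> \<alpha> = \<alpha>^4 \<beta>, one step of \<alpha> before
  \<beta> becomes four steps after it.\<close>

lemma wt_\<beta>:
  assumes "f \<in> wt d k"
  shows "(\<lambda>x. f (\<beta> x)) \<in> wt d (4 * k)"
  using assms wt_\<alpha>_pow[OF assms, of _ 4] unfolding wt_def
  by (auto simp: P_\<beta> \<beta>_\<alpha> mult.commute)

lemma wt_\<beta>\<beta>:
  assumes "f \<in> wt d k"
  shows "(\<lambda>x. f (\<beta> (\<beta> x))) \<in> wt d (7 * k)"
proof (rule wt_cast[OF wt_\<beta>[OF wt_\<beta>[OF assms]] _ order_refl])
  have "4 * (4 * k) = 7 * k + k * 9" by simp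
  then show "4 * (4 * k) mod 9 = 7 * k mod 9" by (simp only: mod_mult_self1)
qed

section \<open>Traces of \<alpha>-invariants and the orbit relation\<close>

definition tr :: "('x \<Rightarrow> 'k) \<Rightarrow> 'x \<Rightarrow> 'k" where
  "tr f x = f x + f (\<beta> x) + f (\<beta> (\<beta> x))"

text \<open>An invariant is one third of its own trace, and by \<open>tr_step\<close> the trace of
  an \<alpha>-invariant is invariant. So the relation says that no invariant of degree at most 10
  tells the two points apart.\<close>

definition same_traces :: "'x \<Rightarrow> 'x \<Rightarrow> bool" where
  "same_traces v w \<longleftrightarrow> (\<forall>f\<in>wt 10 0. tr f v = tr f w)"

lemma same_tracesD:
  assumes "same_traces v w" "f \<in> wt d k" "d \<le> 10" "k mod 9 = 0"
  shows "f v + f (\<beta> v) + f (\<beta> (\<beta> v)) = f w + f (\<beta> w) + f (\<beta> (\<beta> w))"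
  using assms(1) wt_cast[OF assms(2), of 0 10] assms(3,4) by (auto simp: same_traces_def tr_def)

lemma same_traces_sym: "same_traces v w \<Longrightarrow> same_traces w v"
  by (auto simp: same_traces_def)

text \<open>Orbits are described without a group, as the reflexive transitive closure of moving by
  one generator. It is symmetric because the generators have finite order.\<close>

definition step :: "'x \<Rightarrow> 'x \<Rightarrow> bool" where
  "step v w \<longleftrightarrow> v \<in> X \<and> (w = \<alpha> v \<or> w = \<beta> v)"

abbreviation conn :: "'x \<Rightarrow> 'x \<Rightarrow> bool" where "conn \<equiv> step\<^sup>*\<^sup>*"

lemma conn_\<alpha>: "v \<in> X \<Longrightarrow> conn v (\<alpha> v)" and conn_\<beta>: "v \<in> X \<Longrightarrow> conn v (\<beta> v)"
  by (auto simp: step_def)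

lemma conn_\<alpha>_pow: "v \<in> X \<Longrightarrow> conn v ((\<alpha> ^^ i) v)"
  by (induction i) (auto intro: rtranclp_trans[OF _ conn_\<alpha>])

lemma conn_\<beta>_pow: "v \<in> X \<Longrightarrow> conn v ((\<beta> ^^ i) v)"
  by (induction i) (auto intro: rtranclp_trans[OF _ conn_\<beta>])

lemma conn_sym:
  assumes "conn v w"
  shows "conn w v"
  using assms
proof (induction rule: rtranclp_induct)
  case (step y z)
  have "y \<in> X" using step(2) by (simp add: step_def)
  have "z = \<alpha> y \<or> z = \<beta> y" using step(2) by (simp add: step_def)
  then have "conn z y"
  proof
    assume z: "z = \<alpha> y"
    have "(\<alpha> ^^ 8) (\<alpha> y) = (\<alpha> ^^ Suc 8) y" unfolding funpow_Suc_right by simp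
    then have "(\<alpha> ^^ 8) z = y" using z \<alpha>_9[OF \<open>y \<in> X\<close>] by simp
    then show ?thesis using conn_\<alpha>_pow[of z 8] \<open>y \<in> X\<close> z by simp
  next
    assume z: "z = \<beta> y"
    then show ?thesis
      using conn_\<beta>[of z] conn_\<beta>[of "\<beta> z"] \<open>y \<in> X\<close> by (auto intro: rtranclp_trans)
  qed
  then show ?case using step(3) by (rule rtranclp_trans)
qed simp

lemma conn_in: "conn v w \<Longrightarrow> v \<in> X \<Longrightarrow> w \<in> X"
  by (induction rule: rtranclp_induct) (auto simp: step_def)

text \<open>Moving \<beta> and \<beta>^2 past \<alpha> leaves powers of \<alpha>, which f ignores,
  while \<beta> permutes the three summands cyclically.\<close>

lemma tr_step:
  assumes f: "f \<in> wt d 0" and y: "y \<in> X"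
  shows "tr f (\<alpha> y) = tr f y" "tr f (\<beta> y) = tr f y"
proof -
  have "f ((\<alpha> ^^ i) x) = f x" if "x \<in> X" for x i using wt_\<alpha>_pow[OF f that] by simp
  moreover have "\<beta> (\<beta> (\<alpha> y)) = (\<alpha> ^^ 16) (\<beta> (\<beta> y))"
  proof -
    have *: "\<beta> ((\<alpha> ^^ i) x) = (\<alpha> ^^ (4 * i)) (\<beta> x)" if "x \<in> X" for x i
      using that by (induction i) (auto simp: \<beta>_\<alpha> funpow_add)
    show ?thesis using y *[of "\<beta> y" 4] by (simp add: \<beta>_\<alpha>)
  qed
  moreover have "f (\<alpha> y) = f y" using wt_\<alpha>[OF f y] by simp
  ultimately show "tr f (\<alpha> y) = tr f y" "tr f (\<beta> y) = tr f y"
    using y unfolding tr_def by (auto simp: \<beta>_\<alpha>)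
qed

lemma same_traces_conn: "conn w w' \<Longrightarrow> same_traces v w \<Longrightarrow> same_traces v w'"
proof (induction rule: rtranclp_induct)
  case (step y z)
  then have "tr f z = tr f y" if "f \<in> wt 10 0" for f
    using tr_step[OF that] by (auto simp: step_def)
  then show ?case using step by (simp add: same_traces_def)
qed simp

lemma same_traces_conn': "conn v v' \<Longrightarrow> same_traces v w \<Longrightarrow> same_traces v' w"
  using same_traces_conn same_traces_sym by blast

text \<open>Discrete Fourier transform for the cyclic group generated by \<alpha>.\<close>

lemma weight_projection:
  assumes "u \<in> P 1"
  defines "pr \<equiv> \<lambda>k x. inverse 9 * (\<Sum>i<9. inverse \<zeta> ^ (k * i) * u ((\<alpha> ^^ i) x))"
  shows "pr k \<in> wt 1 k" "x \<in> X \<Longrightarrow> u x = (\<Sum>k<9. pr k x)"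
proof -
  have P_smult: "(\<lambda>x. c * f x) \<in> P d" if "f \<in> P d" for f c d
    using P_mult[OF P_const that] by simp
  have P_\<alpha>_pow: "(\<lambda>x. u ((\<alpha> ^^ i) x)) \<in> P 1" for i
  proof (induction i)
    case (Suc i)
    then show ?case using P_\<alpha>[OF Suc] by (simp only: funpow_Suc_right o_def)
  qed (use assms in auto)
  have "(\<lambda>x. \<Sum>i<n. inverse \<zeta> ^ (k * i) * u ((\<alpha> ^^ i) x)) \<in> P 1" for n
  proof (induction n)
    case 0
    show ?case using P_mono[OF P_const[of 0], of 1] by simp
  next
    case (Suc n)
    show ?case unfolding sum.lessThan_Suc by (intro P_add Suc P_smult P_\<alpha>_pow)
  qed
  then have 1: "pr k \<in> P 1" unfolding pr_def by (rule P_smult)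
  have "pr k (\<alpha> x) = \<zeta> ^ k * pr k x" if x: "x \<in> X" for x
  proof -
    let ?g = "\<lambda>i. inverse \<zeta> ^ (k * i) * u ((\<alpha> ^^ i) x)"
    have i9: "inverse \<zeta> ^ 9 = 1" using \<zeta>_9 by (simp add: power_inverse)
    then have "inverse \<zeta> ^ (k * 9) = 1" by (metis mult.commute power_mult power_one)
    \<comment> \<open>Shifting the summation index exchanges only the two end terms, and these
      coincide.\<close>
    then have "?g 9 = ?g 0" using \<alpha>_9[OF x] by simp
    then have sh: "(\<Sum>i<9. ?g (Suc i)) = (\<Sum>i<9. ?g i)"
      using sum.lessThan_Suc_shift[of ?g 9] sum.lessThan_Suc[of ?g 9] by simp
    have "inverse \<zeta> ^ (k * i) * u ((\<alpha> ^^ i) (\<alpha> x)) = \<zeta> ^ k * ?g (Suc i)" for i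
      using \<zeta>_nz by (simp only: funpow_Suc_right o_def) (simp add: power_add field_simps)
    then have "(\<Sum>i<9. inverse \<zeta> ^ (k * i) * u ((\<alpha> ^^ i) (\<alpha> x))) = \<zeta> ^ k * (\<Sum>i<9. ?g (Suc i))"
      by (simp only: sum_distrib_left)
    then show ?thesis unfolding pr_def sh by simp
  qed
  with 1 show "pr k \<in> wt 1 k" by (auto simp: wt_def)
  assume x: "x \<in> X"
  \<comment> \<open>Orthogonality of characters: the geometric sum over a nontrivial ninth root of
    unity vanishes.\<close>
  have orth: "(\<Sum>k<9. inverse \<zeta> ^ (k * i)) = (if i = 0 then 9 else 0)" if "i < 9" for i
  proof (cases "i = 0")
    case False
    let ?z = "inverse \<zeta> ^ i"
    have "?z \<noteq> 1" using False \<zeta>_prim[of i] that by (simp add: power_inverse)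
    moreover have "?z ^ 9 = 1"
      using \<zeta>_9 by (metis inverse_1 mult.commute power_inverse power_mult power_one)
    then have "(1 - ?z) * (\<Sum>k<9. ?z ^ k) = 0"
      using one_diff_power_eq[of ?z 9] by simp
    ultimately have "(\<Sum>k<9. ?z ^ k) = 0" by simp
    then show ?thesis using False by (simp add: power_mult[symmetric] mult.commute)
  qed simp
  have "(\<Sum>k<9. pr k x) = inverse 9 * (\<Sum>k<9. \<Sum>i<9. inverse \<zeta> ^ (k * i) * u ((\<alpha> ^^ i) x))"
    unfolding pr_def by (simp only: sum_distrib_left)
  also have "\<dots> = inverse 9 * (\<Sum>i<9. \<Sum>k<9. inverse \<zeta> ^ (k * i) * u ((\<alpha> ^^ i) x))"
    by (subst sum.swap) rule
  also have "\<dots> = inverse 9 * (\<Sum>i<9. (\<Sum>k<9. inverse \<zeta> ^ (k * i)) * u ((\<alpha> ^^ i) x))"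
    by (simp only: sum_distrib_right)
  also have "\<dots> = inverse 9 * (\<Sum>i<9. (if i = 0 then 9 else 0) * u ((\<alpha> ^^ i) x))"
    using orth by (intro arg_cong2[of _ _ _ _ "(*)"] sum.cong) auto
  also have "\<dots> = u x" by (simp add: if_distrib[of "\<lambda>a. a * _"] sum.If_cases cong: if_cong) 
  finally show "u x = (\<Sum>k<9. pr k x)" by simp
qed

lemma weights_separate:
  assumes "v \<in> X" "w \<in> X" "\<And>k u. k < 9 \<Longrightarrow> u \<in> wt 1 k \<Longrightarrow> u v = u w"
  shows "v = w"
proof (rule P_separates)
  fix u assume u: "u \<in> P 1"
  show "u v = u w"
    unfolding weight_projection(2)[OF u \<open>v \<in> X\<close>] weight_projection(2)[OF u \<open>w \<in> X\<close>]
    by (rule sum.cong[OF HOL.refl], rule assms(3)[OF _ weight_projection(1)[OF u]]) (simp only: lessThan_iff)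
qed (use assms in auto)

section \<open>Separation by traces of low degree\<close>

text \<open>The first three power sums of h on the two \<beta>-orbits agree, hence so do the
  multisets of values, and some \<open>w'\<close> in the \<beta>-orbit of w has the same value as v.
  A polynomial in h vanishing at the other two values isolates v and \<open>w'\<close> in the
  traces. It has degree 2 in h, or degree 1 if these two values coincide, which explains the two
  degree bounds.\<close>

lemma level_set:
  assumes tr: "same_traces v w" and X: "v \<in> X" "w \<in> X" and h: "h \<in> wt d 0" and d: "3 * d \<le> 10"
    and neq: "h v \<noteq> h (\<beta> v)" "h v \<noteq> h (\<beta> (\<beta> v))"
  obtains w' where "conn w w'" "w' \<in> X"
    "\<And>g e. g \<in> wt e 0 \<Longrightarrow> 2 * d + e \<le> 10 \<Longrightarrow> g v = g w'"
    "\<And>g e. h (\<beta> v) = h (\<beta> (\<beta> v)) \<Longrightarrow> g \<in> wt e 0 \<Longrightarrow> d + e \<le> 10 \<Longrightarrow> g v = g w'"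
proof -
  have pw: "h v ^ n + h (\<beta> v) ^ n + h (\<beta> (\<beta> v)) ^ n = h z ^ n + h (\<beta> z) ^ n + h (\<beta> (\<beta> z)) ^ n"
    if "same_traces v z" "n \<le> 3" for z n
  proof -
    have "n * d \<le> 3 * d" using that(2) by (rule mult_le_mono1)
    then have "n * d \<le> 10" using d by linarith
    from same_tracesD[OF that(1) wt_power[OF h] this] show ?thesis by simp
  qed
  have "(h v - h w) * (h v - h (\<beta> w)) * (h v - h (\<beta> (\<beta> w))) = 0"
    using power_sums_3[of "h v" "h (\<beta> v)" "h (\<beta> (\<beta> v))" "h w" "h (\<beta> w)" "h (\<beta> (\<beta> w))" "h v"]
      pw[OF tr, of 1] pw[OF tr, of 2] pw[OF tr, of 3] by simp
  then have "\<exists>w'\<in>{w, \<beta> w, \<beta> (\<beta> w)}. h w' = h v" by auto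
  then obtain w' where w': "w' \<in> {w, \<beta> w, \<beta> (\<beta> w)}" "h w' = h v" by blast
  have c: "conn w w'"
    using w'(1) X(2) conn_\<beta>[of w] conn_\<beta>[of "\<beta> w"] by (auto intro: rtranclp_trans)
  have w'X: "w' \<in> X" using conn_in[OF c X(2)] .
  have tr': "same_traces v w'" using same_traces_conn[OF c tr] .
  define b c b' c' where "b = h (\<beta> v)" "c = h (\<beta> (\<beta> v))" "b' = h (\<beta> w')" "c' = h (\<beta> (\<beta> w'))"
  note bc = this
  have e1: "b + c = b' + c'" using pw[OF tr', of 1] w'(2) by (simp add: bc)
  have e2: "b ^ 2 + c ^ 2 = b' ^ 2 + c' ^ 2" using pw[OF tr', of 2] w'(2) by (simp add: bc)
  have "2 * (b * c) = (b + c)^2 - (b^2 + c^2)" by (simp add: power2_eq_square algebra_simps)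
  also have "\<dots> = 2 * (b' * c')" unfolding e1 e2 by (simp add: power2_eq_square algebra_simps)
  finally have e3: "b * c = b' * c'" by (subst (asm) mult_cancel_left) simp
  have vieta: "(y - b) * (y - c) = y * y - (b + c) * y + b * c" for y b c :: 'k
    by (simp add: algebra_simps)
  \<comment> \<open>Both pairs are the roots of one quadratic; putting y = b' and y = c' places b'
    and c' in {b, c}.\<close>
  have "(y - b) * (y - c) = (y - b') * (y - c')" for y by (simp only: vieta e1 e3)
  then have q: "(b' - b) * (b' - c) = 0" "(c' - b) * (c' - c) = 0" by simp_all
  have nz: "h v - b \<noteq> 0" "h v - c \<noteq> 0" using neq by (simp_all add: bc)
  show ?thesis
  proof
    fix g e assume g: "g \<in> wt e 0" and de: "2 * d + e \<le> 10"
    have "(\<lambda>x. (h x - b) * (h x - c) * g x) \<in> wt (d + d + e) (0 + 0 + 0)"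
      by (intro wt_mult wt_diff_const h g)
    from same_tracesD[OF tr' this] de
    have "(h v - b) * (h v - c) * g v + (b - b) * (b - c) * g (\<beta> v) + (c - b) * (c - c) * g (\<beta> (\<beta> v)) =
        (h v - b) * (h v - c) * g w' + (b' - b) * (b' - c) * g (\<beta> w') + (c' - b) * (c' - c) * g (\<beta> (\<beta> w'))"
      by (simp add: bc w'(2))
    then have "(h v - b) * (h v - c) * g v = (h v - b) * (h v - c) * g w'"
      unfolding q by simp
    then show "g v = g w'" using nz by simp
  next
    fix g e assume eq: "h (\<beta> v) = h (\<beta> (\<beta> v))" and g: "g \<in> wt e 0" and de: "d + e \<le> 10"
    have "(\<lambda>x. (h x - b) * g x) \<in> wt (d + e) (0 + 0)"
      by (intro wt_mult wt_diff_const h g)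
    from same_tracesD[OF tr' this] de
    have "(h v - b) * g v = (h v - b) * g w'"
      using q w'(2) eq by (simp add: bc)
    then show "g v = g w'" using nz by simp
  qed (fact c w'X)+
qed

lemma wt_monomial:
  assumes "t \<in> wt 1 k"
  shows "(\<lambda>x. t x ^ i * t (\<beta> x) ^ j * t (\<beta> (\<beta> x)) ^ l) \<in> wt (i + j + l) (i * k + j * (4 * k) + l * (7 * k))"
  using wt_mult[OF wt_mult[OF wt_power[OF assms] wt_power[OF wt_\<beta>[OF assms]]] wt_power[OF wt_\<beta>\<beta>[OF assms]]]
  by (simp only: mult_1_right)

lemma invariant_monomial:
  assumes "t \<in> wt 1 1" "i + j + l \<le> d" "(i + 4 * j + 7 * l) mod 9 = 0"
  shows "(\<lambda>x. t x ^ i * t (\<beta> x) ^ j * t (\<beta> (\<beta> x)) ^ l) \<in> wt d 0"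
  by (rule wt_cast[OF wt_monomial[OF assms(1)]]) (use assms in \<open>auto simp: mult.commute\<close>)

text \<open>A form u of weight k becomes an invariant of degree at most d after multiplication by a
  semi-invariant m of opposite weight. Since m has the same nonzero value at both points, it can be
  cancelled.\<close>

lemma eq_if_semi_invariants:
  assumes "v \<in> X" "w \<in> X" and inv: "\<And>g. g \<in> wt d 0 \<Longrightarrow> g v = g w"
    and ex: "\<And>k. k < 9 \<Longrightarrow> \<exists>m e l. m \<in> wt e l \<and> e + 1 \<le> d \<and> (k + l) mod 9 = 0 \<and> m v = m w \<and> m v \<noteq> 0"
  shows "v = w"
proof (rule weights_separate)
  fix k u assume "k < (9::nat)" and u: "u \<in> wt 1 k"
  obtain m e l where m: "m \<in> wt e l" "e + 1 \<le> d" "(k + l) mod 9 = 0" "m v = m w" "m v \<noteq> 0"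
    using ex[OF \<open>k < 9\<close>] by auto
  have "(\<lambda>x. u x * m x) \<in> wt d 0" using m by (intro wt_cast[OF wt_mult[OF u m(1)]]) auto
  from inv[OF this] show "u v = u w" using m by simp
qed (use assms in auto)

lemma less_9_cases:
  "(k::nat) < 9 \<Longrightarrow> k = 0 \<or> k = 1 \<or> k = 2 \<or> k = 3 \<or> k = 4 \<or> k = 5 \<or> k = 6 \<or> k = 7 \<or> k = 8"
  by linarith

text \<open>The weights of t, t o \<beta> and t o \<beta>^2 are 1, 4 and 7; within degree 3 their
  monomials reach every class modulo 9.\<close>

lemma exponents_3: "(k::nat) < 9 \<Longrightarrow> \<exists>i j l. i + j + l \<le> 3 \<and> (k + (i + 4 * j + 7 * l)) mod 9 = 0"
proof (drule less_9_cases, elim disjE)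
  show "k = 0 \<Longrightarrow> ?thesis" by (intro exI[of _ 0]) simp
  show "k = 1 \<Longrightarrow> ?thesis" by (rule exI[of _ 1], rule exI[of _ 0], rule exI[of _ 1]) simp
  show "k = 2 \<Longrightarrow> ?thesis" by (rule exI[of _ 0], rule exI[of _ 0], rule exI[of _ 1]) simp
  show "k = 3 \<Longrightarrow> ?thesis" by (rule exI[of _ 0], rule exI[of _ 2], rule exI[of _ 1]) simp
  show "k = 4 \<Longrightarrow> ?thesis" by (rule exI[of _ 1], rule exI[of _ 1], rule exI[of _ 0]) simp
  show "k = 5 \<Longrightarrow> ?thesis" by (rule exI[of _ 0], rule exI[of _ 1], rule exI[of _ 0]) simp
  show "k = 6 \<Longrightarrow> ?thesis" by (rule exI[of _ 3], rule exI[of _ 0], rule exI[of _ 0]) simp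
  show "k = 7 \<Longrightarrow> ?thesis" by (rule exI[of _ 2], rule exI[of _ 0], rule exI[of _ 0]) simp
  show "k = 8 \<Longrightarrow> ?thesis" by (rule exI[of _ 1], rule exI[of _ 0], rule exI[of _ 0]) simp
qed

text \<open>The version without the middle coordinate: the weights 1 and 7 alone reach every class
  within degree 6.\<close>

lemma exponents_6: "(k::nat) < 9 \<Longrightarrow> \<exists>i l. i + l \<le> 6 \<and> (k + (i + 7 * l)) mod 9 = 0"
proof (drule less_9_cases, elim disjE)
  show "k = 0 \<Longrightarrow> ?thesis" by (intro exI[of _ 0]) simp
  show "k = 1 \<Longrightarrow> ?thesis" by (rule exI[of _ 1], rule exI[of _ 1]) simp
  show "k = 2 \<Longrightarrow> ?thesis" by (rule exI[of _ 0], rule exI[of _ 1]) simp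
  show "k = 3 \<Longrightarrow> ?thesis" by (rule exI[of _ 6], rule exI[of _ 0]) simp
  show "k = 4 \<Longrightarrow> ?thesis" by (rule exI[of _ 0], rule exI[of _ 2]) simp
  show "k = 5 \<Longrightarrow> ?thesis" by (rule exI[of _ 4], rule exI[of _ 0]) simp
  show "k = 6 \<Longrightarrow> ?thesis" by (rule exI[of _ 3], rule exI[of _ 0]) simp
  show "k = 7 \<Longrightarrow> ?thesis" by (rule exI[of _ 2], rule exI[of _ 0]) simp
  show "k = 8 \<Longrightarrow> ?thesis" by (rule exI[of _ 1], rule exI[of _ 0]) simp
qed

text \<open>The quotient of the two values is a ninth root of unity, that is, the effect of a power
  of \<alpha> on t. Such a power changes neither \<alpha>-invariants nor the vanishing of
  semi-invariants.\<close>

lemma align_root: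
  assumes "v \<in> X" "t \<in> wt 1 1" "t v \<noteq> 0" "t v ^ 9 = t w ^ 9"
  obtains v' where "conn v v'" "v' \<in> X" "t v' = t w" "\<And>d g. g \<in> wt d 0 \<Longrightarrow> g v' = g v"
    "\<And>f d k. f \<in> wt d k \<Longrightarrow> f v = 0 \<Longrightarrow> f v' = 0"
proof -
  have "(t w / t v) ^ 9 = 1" using assms(3) by (simp add: power_divide flip: assms(4))
  then obtain i where i: "t w / t v = \<zeta> ^ i" using root_9 by blast
  show ?thesis
  proof
    show "conn v ((\<alpha> ^^ i) v)" using assms(1) by (rule conn_\<alpha>_pow)
    show "t ((\<alpha> ^^ i) v) = t w"
      using wt_\<alpha>_pow[OF assms(2,1)] i assms(3) by (simp add: field_simps)
  qed (use assms(1) in \<open>auto simp: wt_\<alpha>_pow\<close>)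
qed

text \<open>The ninth power of t exceeds the degree bound, but it is determined by invariant cubics.
  Once t is aligned by a power of \<alpha>, the cubics yield the other two coordinates, and
  monomials of degree at most 3 cancel every weight, whence the bound 3 + 1.\<close>

lemma conn_if_all_coordinates:
  assumes X: "v \<in> X" "w \<in> X" and t: "t \<in> wt 1 1"
    and nz: "t v \<noteq> 0" "t (\<beta> v) \<noteq> 0" "t (\<beta> (\<beta> v)) \<noteq> 0"
    and inv: "\<forall>g\<in>wt 4 0. g v = g w"
  shows "conn v w"
proof -
  have s: "t x ^ 2 * t (\<beta> (\<beta> x)) = t w ^ 2 * t (\<beta> (\<beta> w))"
     "t x * t (\<beta> x) ^ 2 = t w * t (\<beta> w) ^ 2"
     "t (\<beta> x) * t (\<beta> (\<beta> x)) ^ 2 = t (\<beta> w) * t (\<beta> (\<beta> w)) ^ 2"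
    if "\<forall>g\<in>wt 4 0. g x = g w" for x
    using that[rule_format, OF invariant_monomial[OF t, of 2 0 1 4]] that[rule_format, OF invariant_monomial[OF t, of 1 2 0 4]]
      that[rule_format, OF invariant_monomial[OF t, of 0 1 2 4]] by simp_all
  \<comment> \<open>Both sides are x0^9 x1^2 x2^4, written through the three cubics of
    \<open>s\<close>.\<close>
  have id: "x0 ^ 9 * (x1 * x2\<^sup>2) ^ 2 = (x0 * x1\<^sup>2) * (x0\<^sup>2 * x2) ^ 4" for x0 x1 x2 :: 'k
    by (simp add: eval_nat_numeral algebra_simps)
  have w2: "t (\<beta> w) * t (\<beta> (\<beta> w)) ^ 2 \<noteq> 0" unfolding s(3)[OF inv, symmetric] using nz by simp
  have "t v ^ 9 * (t (\<beta> w) * t (\<beta> (\<beta> w)) ^ 2) ^ 2 = t w ^ 9 * (t (\<beta> w) * t (\<beta> (\<beta> w)) ^ 2) ^ 2"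
    using id[of "t v" "t (\<beta> v)" "t (\<beta> (\<beta> v))"] id[of "t w" "t (\<beta> w)" "t (\<beta> (\<beta> w))"]
    by (simp only: s[OF inv])
  then have "t v ^ 9 = t w ^ 9" using w2 by simp
  then obtain v' where v': "conn v v'" "v' \<in> X" "t v' = t w" "\<And>d g. g \<in> wt d 0 \<Longrightarrow> g v' = g v"
    using align_root[OF X(1) t nz(1)] by metis
  have inv': "\<forall>g\<in>wt 4 0. g v' = g w"
  proof
    fix g assume g: "g \<in> wt 4 0"
    show "g v' = g w" using v'(4)[OF g] bspec[OF inv g] by simp
  qed
  have tw: "t w \<noteq> 0" using s(1)[OF inv] nz by auto
  have x2: "t (\<beta> (\<beta> v')) = t (\<beta> (\<beta> w))" using s(1)[OF inv'] tw v'(3) by simp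
  have x1: "t (\<beta> v') = t (\<beta> w)" using s(3)[OF inv'] w2 x2 by simp
  have "v' = w"
  proof (rule eq_if_semi_invariants[OF v'(2) X(2) inv'[rule_format]])
    fix k :: nat assume "k < 9"
    then obtain i j l where ijl: "i + j + l \<le> 3" "(k + (i + 4 * j + 7 * l)) mod 9 = 0"
      using exponents_3[OF \<open>k < 9\<close>] by auto
    show "\<exists>m e l. m \<in> wt e l \<and> e + 1 \<le> 4 \<and> (k + l) mod 9 = 0 \<and> m v' = m w \<and> m v' \<noteq> 0"
      using wt_monomial[OF t, of i j l] ijl x1 x2 v'(3) tw w2
      by (intro exI[of _ "\<lambda>x. t x ^ i * t (\<beta> x) ^ j * t (\<beta> (\<beta> x)) ^ l"] exI[of _ "i + j + l"]
          exI[of _ "i + 4 * j + 7 * l"]) (auto simp: mult.commute)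
  qed
  with v'(1) show ?thesis by simp
qed

text \<open>The same argument without t o \<beta>, which may vanish. The invariant t (t o
  \<beta>^2)^5 replaces the two lost cubics, and cancelling weights takes monomials of degree up to
  6, whence the bound 6 + 1.\<close>

lemma conn_if_two_coordinates:
  assumes X: "v \<in> X" "w \<in> X" and t: "t \<in> wt 1 1"
    and nz: "t v \<noteq> 0" "t (\<beta> (\<beta> v)) \<noteq> 0"
    and inv: "\<forall>g\<in>wt 7 0. g v = g w"
  shows "conn v w"
proof -
  have s: "t x ^ 2 * t (\<beta> (\<beta> x)) = t w ^ 2 * t (\<beta> (\<beta> w))"
     "t x * t (\<beta> (\<beta> x)) ^ 5 = t w * t (\<beta> (\<beta> w)) ^ 5"
    if "\<forall>g\<in>wt 7 0. g x = g w" for x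
    using that[rule_format, OF invariant_monomial[OF t, of 2 0 1 7]] that[rule_format, OF invariant_monomial[OF t, of 1 0 5 7]]
    by simp_all
  have id: "x0 ^ 9 * (x0 * x2 ^ 5) = (x0\<^sup>2 * x2) ^ 5" for x0 x2 :: 'k
    by (simp add: eval_nat_numeral algebra_simps)
  have w2: "t w * t (\<beta> (\<beta> w)) ^ 5 \<noteq> 0" unfolding s(2)[OF inv, symmetric] using nz by simp
  have "t v ^ 9 * (t w * t (\<beta> (\<beta> w)) ^ 5) = t w ^ 9 * (t w * t (\<beta> (\<beta> w)) ^ 5)"
    using id[of "t v" "t (\<beta> (\<beta> v))"] id[of "t w" "t (\<beta> (\<beta> w))"]
    by (simp only: s[OF inv])
  then have "t v ^ 9 = t w ^ 9" using w2 by simp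
  then obtain v' where v': "conn v v'" "v' \<in> X" "t v' = t w" "\<And>d g. g \<in> wt d 0 \<Longrightarrow> g v' = g v"
    using align_root[OF X(1) t nz(1)] by metis
  have inv': "\<forall>g\<in>wt 7 0. g v' = g w"
  proof
    fix g assume g: "g \<in> wt 7 0"
    show "g v' = g w" using v'(4)[OF g] bspec[OF inv g] by simp
  qed
  have tw: "t w \<noteq> 0" using w2 by simp
  have x2: "t (\<beta> (\<beta> v')) = t (\<beta> (\<beta> w))" using s(1)[OF inv'] tw v'(3) by simp
  have "v' = w"
  proof (rule eq_if_semi_invariants[OF v'(2) X(2) inv'[rule_format]])
    fix k :: nat assume "k < 9"
    then obtain i l where il: "i + l \<le> 6" "(k + (i + 7 * l)) mod 9 = 0"
      using exponents_6[OF \<open>k < 9\<close>] by auto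
    show "\<exists>m e l. m \<in> wt e l \<and> e + 1 \<le> 7 \<and> (k + l) mod 9 = 0 \<and> m v' = m w \<and> m v' \<noteq> 0"
      using wt_monomial[OF t, of i 0 l] il x2 v'(3) w2
      by (intro exI[of _ "\<lambda>x. t x ^ i * t (\<beta> (\<beta> x)) ^ l"] exI[of _ "i + l"]
          exI[of _ "i + 7 * l"]) (auto simp: mult.commute)
  qed
  with v'(1) show ?thesis by simp
qed

text \<open>The cubic t^2 (t o \<beta>^2) is used in \<open>level_set\<close>. If its other two
  values coincide, invariants up to degree 10 - 3 = 7 are available; otherwise only up to degree 10
  - 6 = 4, but then all three coordinates are nonzero.\<close>

lemma conn_if_cubic_singleton:
  assumes tr: "same_traces v w" and X: "v \<in> X" "w \<in> X" and t: "t \<in> wt 1 1"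
    and neq: "t v ^ 2 * t (\<beta> (\<beta> v)) \<noteq> t (\<beta> v) ^ 2 * t v"
      "t v ^ 2 * t (\<beta> (\<beta> v)) \<noteq> t (\<beta> (\<beta> v)) ^ 2 * t (\<beta> v)"
  shows "conn v w"
proof -
  let ?s = "\<lambda>x. t x ^ 2 * t (\<beta> (\<beta> x))"
  have s: "?s \<in> wt 3 0" using invariant_monomial[OF t, of 2 0 1 3] by simp
  obtain w' where w': "conn w w'" "w' \<in> X"
    "\<And>g e. g \<in> wt e 0 \<Longrightarrow> 2 * 3 + e \<le> 10 \<Longrightarrow> g v = g w'"
    "\<And>g e. ?s (\<beta> v) = ?s (\<beta> (\<beta> v)) \<Longrightarrow> g \<in> wt e 0 \<Longrightarrow> 3 + e \<le> 10 \<Longrightarrow> g v = g w'"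
    using level_set[OF tr X s] neq X by auto
  have "conn v w'"
  proof (cases "?s (\<beta> v) = ?s (\<beta> (\<beta> v))")
    case True
    then have inv: "\<forall>g\<in>wt 7 0. g v = g w'" using w'(4) by simp
    \<comment> \<open>A zero of either coordinate would make the value at v and one of the other two
      values vanish together.\<close>
    have "t v \<noteq> 0" "t (\<beta> (\<beta> v)) \<noteq> 0" using True neq X by auto
    then show ?thesis using conn_if_two_coordinates[OF X(1) w'(2) t _ _ inv] by simp
  next
    case False
    have inv: "\<forall>g\<in>wt 4 0. g v = g w'" using w'(3) by simp
    have "t v \<noteq> 0" "t (\<beta> v) \<noteq> 0" "t (\<beta> (\<beta> v)) \<noteq> 0" using False neq X by auto
    then show ?thesis using conn_if_all_coordinates[OF X(1) w'(2) t _ _ _ inv] by simp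
  qed
  then show ?thesis using conn_sym[OF w'(1)] by (rule rtranclp_trans)
qed

text \<open>Of three values that are not all equal, one differs from both others; a
  \<beta>-translate of v puts it first.\<close>

lemma conn_if_cubics_differ:
  assumes tr: "same_traces v w" and X: "v \<in> X" "w \<in> X" and t: "t \<in> wt 1 1"
    and neq: "\<not> (t v ^ 2 * t (\<beta> (\<beta> v)) = t (\<beta> v) ^ 2 * t v \<and>
      t (\<beta> v) ^ 2 * t v = t (\<beta> (\<beta> v)) ^ 2 * t (\<beta> v))"
  shows "conn v w"
proof -
  have c: "conn v (\<beta> v)" "conn v (\<beta> (\<beta> v))" 
    using X conn_\<beta>[of v] conn_\<beta>[of "\<beta> v"] by (auto intro: rtranclp_trans)
  let ?s = "t v ^ 2 * t (\<beta> (\<beta> v))" and ?s1 = "t (\<beta> v) ^ 2 * t v" and ?s2 = "t (\<beta> (\<beta> v)) ^ 2 * t (\<beta> v)"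
  consider "?s \<noteq> ?s1" "?s \<noteq> ?s2" | "?s1 \<noteq> ?s" "?s1 \<noteq> ?s2" | "?s2 \<noteq> ?s" "?s2 \<noteq> ?s1"
    using neq by metis
  then show ?thesis
  proof cases
    case 1
    then show ?thesis using conn_if_cubic_singleton[OF tr X t] by blast
  next
    case 2
    then have "conn (\<beta> v) w"
      using conn_if_cubic_singleton[OF same_traces_conn'[OF c(1) tr] _ X(2) t] X by simp
    with c(1) show ?thesis by (rule rtranclp_trans)
  next
    case 3
    then have "conn (\<beta> (\<beta> v)) w"
      using conn_if_cubic_singleton[OF same_traces_conn'[OF c(2) tr] _ X(2) t] X by simp
    with c(2) show ?thesis by (rule rtranclp_trans)
  qed
qed

text \<open>The case that forces degree 10: every \<open>u\<close> of weight \<open>0\<close> has to be paired with \<open>t\<^sup>9\<close>.\<close>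

lemma conn_if_one_coordinate:
  assumes tr: "same_traces v w" and X: "v \<in> X" "w \<in> X" and t: "t \<in> wt 1 1"
    and nz: "t v \<noteq> 0" "t (\<beta> v) = 0" "t (\<beta> (\<beta> v)) = 0"
  shows "conn v w"
proof (cases "t w ^ 2 * t (\<beta> (\<beta> w)) = t (\<beta> w) ^ 2 * t w \<and> t (\<beta> w) ^ 2 * t w = t (\<beta> (\<beta> w)) ^ 2 * t (\<beta> w)")
  case False
  then show ?thesis
    using conn_if_cubics_differ[OF same_traces_sym[OF tr] X(2,1) t] conn_sym by blast
next
  case True
  have "(\<lambda>x. t x ^ 2 * t (\<beta> (\<beta> x))) \<in> wt 3 0" using invariant_monomial[OF t, of 2 0 1 3] by simp
  \<comment> \<open>The trace of the cubic is 0 at v, and its three values at w are equal, so all of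
    them vanish. Thus at most one coordinate of w is nonzero, and the trace of t^9 shows that one
    is.\<close>
  from same_tracesD[OF tr this] True X nz have "3 * (t w ^ 2 * t (\<beta> (\<beta> w))) = 0" by auto
  then have z: "t w ^ 2 * t (\<beta> (\<beta> w)) = 0" "t (\<beta> w) ^ 2 * t w = 0" "t (\<beta> (\<beta> w)) ^ 2 * t (\<beta> w) = 0"
    using True by (metis mult_eq_0_iff zero_neq_numeral)+
  have t9: "(\<lambda>x. t x ^ 9) \<in> wt 9 9" using wt_power[OF t, of 9] by simp
  have "t w \<noteq> 0 \<or> t (\<beta> w) \<noteq> 0 \<or> t (\<beta> (\<beta> w)) \<noteq> 0"
    using same_tracesD[OF tr t9] nz by auto
  then have "\<exists>w'\<in>{w, \<beta> w, \<beta> (\<beta> w)}. t w' \<noteq> 0 \<and> t (\<beta> w') = 0 \<and> t (\<beta> (\<beta> w')) = 0"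
    using z X by auto
  then obtain w' where w': "w' \<in> {w, \<beta> w, \<beta> (\<beta> w)}" "t w' \<noteq> 0" "t (\<beta> w') = 0" "t (\<beta> (\<beta> w')) = 0"
    by blast
  have c: "conn w w'"
    using w'(1) X(2) conn_\<beta>[of w] conn_\<beta>[of "\<beta> w"] by (auto intro: rtranclp_trans)
  have w'X: "w' \<in> X" using conn_in[OF c X(2)] .
  have tr': "same_traces v w'" using same_traces_conn[OF c tr] .
  have "t v ^ 9 = t w' ^ 9" using same_tracesD[OF tr' t9] nz w' by simp
  then obtain v' where v': "conn v v'" "v' \<in> X" "t v' = t w'"
      "\<And>f d k. f \<in> wt d k \<Longrightarrow> f v = 0 \<Longrightarrow> f v' = 0"
    using align_root[OF X(1) t nz(1)] by metis
  have z': "t (\<beta> v') = 0" "t (\<beta> (\<beta> v')) = 0"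
    using v'(4)[OF wt_\<beta>[OF t]] v'(4)[OF wt_\<beta>\<beta>[OF t]] nz by auto
  have tr'': "same_traces v' w'" using same_traces_conn'[OF v'(1) tr'] .
  have "v' = w'"
  proof (rule weights_separate[OF v'(2) w'X])
    fix k u assume k: "k < (9::nat)" and u: "u \<in> wt 1 k"
    \<comment> \<open>The degree is 10 - k, and 9 - k is positive, so in the traces the terms at the
      translates by \<beta> and \<beta>^2 vanish.\<close>
    have "(\<lambda>x. u x * t x ^ (9 - k)) \<in> wt (1 + (9 - k) * 1) (k + (9 - k) * 1)"
      by (intro wt_mult wt_power u t)
    from same_tracesD[OF tr'' this] k z' w' show "u v' = u w'" by (simp add: v'(3) power_0_left)
  qed
  then show ?thesis using v'(1) conn_sym[OF c] by (auto intro: rtranclp_trans)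
qed

text \<open>Different orbits exclude unequal cubics and exactly one nonzero coordinate. With
  coordinates x, y, z, what is left is either zero or satisfies x z = y^2 and x y = z^2, a geometric
  progression whose ratio is a cube root of unity.\<close>

lemma eigenvector_if_not_conn:
  assumes tr: "same_traces v w" and X: "v \<in> X" "w \<in> X" and t: "t \<in> wt 1 1" and nc: "\<not> conn v w"
  shows "\<exists>\<epsilon>. \<epsilon> ^ 3 = 1 \<and> t (\<beta> v) = \<epsilon> * t v \<and> t (\<beta> (\<beta> v)) = \<epsilon> ^ 2 * t v"
proof -
  have e: "t v ^ 2 * t (\<beta> (\<beta> v)) = t (\<beta> v) ^ 2 * t v" "t (\<beta> v) ^ 2 * t v = t (\<beta> (\<beta> v)) ^ 2 * t (\<beta> v)"
    using conn_if_cubics_differ[OF tr X t] nc by auto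
  have c: "conn v (\<beta> v)" "conn v (\<beta> (\<beta> v))" 
    using X conn_\<beta>[of v] conn_\<beta>[of "\<beta> v"] by (auto intro: rtranclp_trans)
  have one: "\<not> (t v' \<noteq> 0 \<and> t (\<beta> v') = 0 \<and> t (\<beta> (\<beta> v')) = 0)" if "conn v v'" for v'
    using conn_if_one_coordinate[OF same_traces_conn'[OF that tr] conn_in[OF that X(1)] X(2) t] nc
      rtranclp_trans[OF that] by blast
  show ?thesis
  proof (cases "t v = 0")
    case True
    with e(2) have "t (\<beta> v) = 0 \<or> t (\<beta> (\<beta> v)) = 0" by auto
    then have "t (\<beta> v) = 0" "t (\<beta> (\<beta> v)) = 0" using True one[OF c(1)] one[OF c(2)] X by auto
    then show ?thesis using True by (intro exI[of _ 1]) simp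
  next
    case False
    let ?x = "t v" and ?y = "t (\<beta> v)" and ?z = "t (\<beta> (\<beta> v))"
    have "?x * (?x * ?z) = ?x * ?y ^ 2" using e(1) by (simp add: power2_eq_square ac_simps)
    then have e1: "?x * ?z = ?y ^ 2" using False by simp
    have y: "?y \<noteq> 0" using e1 one[of v] False by auto
    have "?y * (?y * ?x) = ?y * ?z ^ 2" using e(2) by (simp add: power2_eq_square ac_simps)
    then have e2: "?y * ?x = ?z ^ 2" using y by simp
    have "?y * ?y ^ 3 = (?y ^ 2)^2" by (simp add: power2_eq_square power3_eq_cube)
    also have "\<dots> = ?x ^ 2 * ?z ^ 2" by (simp flip: e1 add: power_mult_distrib)
    also have "\<dots> = ?y * ?x ^ 3" by (simp flip: e2 add: power2_eq_square[of ?x] power3_eq_cube)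
    finally have "?y ^ 3 = ?x ^ 3" using y by simp
    moreover have "?z = (?y / ?x) ^ 2 * ?x"
      using False by (simp add: power_divide power2_eq_square[of ?x] flip: e1)
    ultimately show ?thesis using False
      by (intro exI[of _ "?y / ?x"]) (simp add: power_divide)
  qed
qed

text \<open>Forms of weight 1 are closed under addition. At a point where each of them is an
  eigenvector of \<beta>, this computation, used for f, t and f + t, forces f and t to share one
  eigenvalue.\<close>

lemma eigenvalue_unique:
  fixes c d \<epsilon> \<delta> \<gamma> :: 'k
  assumes "c \<noteq> 0" "d \<noteq> 0" "\<epsilon> * c + \<delta> * d = \<gamma> * (c + d)" "\<epsilon>\<^sup>2 * c + \<delta>\<^sup>2 * d = \<gamma>\<^sup>2 * (c + d)"
  shows "\<epsilon> = \<delta>"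
proof -
  have 1: "(\<epsilon> - \<gamma>) * c = (\<gamma> - \<delta>) * d" using assms(3) by (simp add: algebra_simps)
  have 2: "(\<epsilon> + \<gamma>) * ((\<epsilon> - \<gamma>) * c) = (\<gamma> + \<delta>) * ((\<gamma> - \<delta>) * d)"
    using assms(4) by (simp add: algebra_simps power2_eq_square)
  show ?thesis
  proof (cases "\<epsilon> = \<gamma>")
    case True
    then show ?thesis using 1 assms(2) by simp
  next
    case False
    then have "\<epsilon> + \<gamma> = \<gamma> + \<delta>" using 2 assms(1) unfolding 1[symmetric] by simp
    then show ?thesis by simp
  qed
qed

section \<open>Points with nontrivial stabilizer\<close>

text \<open>Multiplication by 4 fixes the multiples of 3 modulo 9, so \<alpha> and \<beta> commute
  on these weights. The pair (i, j) is a character of C_3 x C_3.\<close>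

definition bwt :: "nat \<Rightarrow> nat \<Rightarrow> nat \<Rightarrow> ('x \<Rightarrow> 'k) set" where
  "bwt d i j = {u \<in> wt d (3 * i). \<forall>x\<in>X. u (\<beta> x) = \<zeta> ^ (3 * j) * u x}"

lemma bwt_wt: "u \<in> bwt d i j \<Longrightarrow> u \<in> wt d (3 * i)"
  by (simp add: bwt_def)

lemma bwt_\<beta>: "u \<in> bwt d i j \<Longrightarrow> x \<in> X \<Longrightarrow> u (\<beta> x) = \<zeta> ^ (3 * j) * u x"
  by (simp add: bwt_def)

lemma bwt_mult: "f \<in> bwt d i j \<Longrightarrow> g \<in> bwt e i' j' \<Longrightarrow> (\<lambda>x. f x * g x) \<in> bwt (d + e) (i + i') (j + j')"
  using wt_mult[of f d "3 * i" g e "3 * i'"] by (auto simp: bwt_def power_add distrib_left)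

lemma bwt_power:
  assumes "f \<in> bwt d i j"
  shows "(\<lambda>x. f x ^ n) \<in> bwt (n * d) (n * i) (n * j)"
proof (induction n)
  case 0
  show ?case using wt_const[of 1] by (simp add: bwt_def)
next
  case (Suc n)
  from bwt_mult[OF assms this] show ?case by simp
qed

lemma three_mod_9: "(3 * i) mod 9 = 0 \<longleftrightarrow> i mod 3 = (0::nat)"
  by presburger

lemma bwt_action:
  assumes u: "u \<in> bwt d i j" and x: "x \<in> X"
  shows "u ((\<alpha> ^^ p) ((\<beta> ^^ q) x)) = \<zeta> ^ (3 * (i * p + j * q)) * u x"
proof -
  have "u ((\<beta> ^^ q) x) = \<zeta> ^ (3 * (j * q)) * u x"
    using x by (induction q) (auto simp: bwt_\<beta>[OF u] power_add distrib_left)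
  then show ?thesis using wt_\<alpha>_pow[OF bwt_wt[OF u], of "(\<beta> ^^ q) x" p] x
    by (simp add: power_add distrib_left mult.assoc)
qed

lemma sum_cube_roots: "1 + \<zeta> ^ 3 + \<zeta> ^ 6 = 0"
proof -
  have "(1 - \<zeta> ^ 3) * (1 + \<zeta> ^ 3 + \<zeta> ^ 6) = 1 - \<zeta> ^ 9"
    by (simp add: eval_nat_numeral algebra_simps)
  moreover have "\<zeta> ^ 3 \<noteq> 1" by (rule \<zeta>_prim) auto
  ultimately show ?thesis using \<zeta>_9 by simp
qed

lemma bwt_decomposition:
  assumes u: "u \<in> wt 1 (3 * i)"
  obtains u0 u1 u2 where "u0 \<in> bwt 1 i 0" "u1 \<in> bwt 1 i 1" "u2 \<in> bwt 1 i 2"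
    "\<And>x. x \<in> X \<Longrightarrow> u x = u0 x + u1 x + u2 x"
proof -
  \<comment> \<open>Averaging over \<beta>; the two coefficients are the inverses of \<zeta>^(3 j)
    and \<zeta>^(6 j).\<close>
  define pr where "pr j x = (1 / 3) * (u x + \<zeta> ^ (6 * j) * u (\<beta> x) + \<zeta> ^ (3 * j) * u (\<beta> (\<beta> x)))" for j x
  have sm: "(\<lambda>x. c * f x) \<in> wt 1 k" if "f \<in> wt 1 k" for f c k
    using wt_mult[OF wt_const that] by simp
  have "4 * (3 * i) = 3 * i + i * 9" "7 * (3 * i) = 3 * i + 2 * i * 9" by simp_all
  then have "4 * (3 * i) mod 9 = (3 * i) mod 9" "7 * (3 * i) mod 9 = (3 * i) mod 9"
    by (simp_all only: mod_mult_self1)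
  then have "(\<lambda>x. u (\<beta> x)) \<in> wt 1 (3 * i)" "(\<lambda>x. u (\<beta> (\<beta> x))) \<in> wt 1 (3 * i)"
    using wt_cast[OF wt_\<beta>[OF u] _ order_refl] wt_cast[OF wt_\<beta>\<beta>[OF u] _ order_refl] by blast+
  then have w: "pr j \<in> wt 1 (3 * i)" for j
    unfolding pr_def by (intro sm wt_add u)
  have pr\<beta>: "pr j (\<beta> x) = \<zeta> ^ (3 * j) * pr j x" if "x \<in> X" for j x
  proof -
    have 9: "\<zeta> ^ (3 * j) * \<zeta> ^ (6 * j) = 1" using \<zeta>_eq_1_iff[of "9 * j"] by (simp flip: power_add)
    have 6: "\<zeta> ^ (3 * j) * \<zeta> ^ (3 * j) = \<zeta> ^ (6 * j)" by (simp flip: power_add)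
    have "\<zeta> ^ (3 * j) * (u x + \<zeta> ^ (6 * j) * u (\<beta> x) + \<zeta> ^ (3 * j) * u (\<beta> (\<beta> x))) =
      \<zeta> ^ (3 * j) * u x + (\<zeta> ^ (3 * j) * \<zeta> ^ (6 * j)) * u (\<beta> x) + (\<zeta> ^ (3 * j) * \<zeta> ^ (3 * j)) * u (\<beta> (\<beta> x))"
      by (simp add: algebra_simps)
    then show ?thesis using that unfolding pr_def 9 6 by simp
  qed
  then have b: "pr j \<in> bwt 1 i j" for j using w by (simp add: bwt_def)
  show ?thesis
  proof
    fix x
    have 12: "\<zeta> ^ 12 = \<zeta> ^ 3" using \<zeta>_mod[of 12] by simp
    have "3 * (pr 0 x + pr 1 x + pr 2 x) =
      3 * u x + (1 + \<zeta> ^ 3 + \<zeta> ^ 6) * u (\<beta> x) + (1 + \<zeta> ^ 3 + \<zeta> ^ 6) * u (\<beta> (\<beta> x))"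
      unfolding pr_def by (simp add: 12 algebra_simps)
    then have "3 * (pr 0 x + pr 1 x + pr 2 x) = 3 * u x" unfolding sum_cube_roots by simp
    then show "u x = pr 0 x + pr 1 x + pr 2 x" by (subst (asm) mult_cancel_left) simp
  qed (rule b)+
qed

lemma bi_weights_separate:
  assumes X: "v \<in> X" "w \<in> X"
    and 1: "\<And>k u. k mod 3 \<noteq> 0 \<Longrightarrow> u \<in> wt 1 k \<Longrightarrow> u v = u w"
    and 2: "\<And>i j u. i < 3 \<Longrightarrow> j < 3 \<Longrightarrow> u \<in> bwt 1 i j \<Longrightarrow> u v = u w"
  shows "v = w"
proof (rule weights_separate[OF X])
  fix k u assume k: "k < (9::nat)" and u: "u \<in> wt 1 k"
  show "u v = u w"
  proof (cases "k mod 3 = 0")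
    case True
    then obtain i where i: "k = 3 * i" "i < 3" using k by (auto simp: dvd_def mod_eq_0_iff_dvd)
    obtain u0 u1 u2 where d: "u0 \<in> bwt 1 i 0" "u1 \<in> bwt 1 i 1" "u2 \<in> bwt 1 i 2"
      "\<And>x. x \<in> X \<Longrightarrow> u x = u0 x + u1 x + u2 x"
      using bwt_decomposition[of u i] u i by metis
    have "u0 v = u0 w" "u1 v = u1 w" "u2 v = u2 w"
      using 2[OF i(2) _ d(1)] 2[OF i(2) _ d(2)] 2[OF i(2) _ d(3)] by simp_all
    then show ?thesis using d(4) X by simp
  qed (use 1 u in auto)
qed

text \<open>Multiplication by 4 splits the classes prime to 3 modulo 9 into {1, 4, 7} and {8, 5, 2},
  so composing with a power of \<beta> reaches weight 1 or 8.\<close>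

lemma unit_weight_shift:
  assumes u: "u \<in> wt 1 k" and k: "k mod 3 \<noteq> 0"
  obtains t where "t \<in> wt 1 1 \<union> wt 1 8"
    "\<And>x. x \<in> X \<Longrightarrow> u x \<in> {t x, t (\<beta> x), t (\<beta> (\<beta> x))}"
    "\<And>x. x \<in> X \<Longrightarrow> u (\<beta> x) \<in> {t x, t (\<beta> x), t (\<beta> (\<beta> x))}"
    "\<And>x. x \<in> X \<Longrightarrow> u (\<beta> (\<beta> x)) \<in> {t x, t (\<beta> x), t (\<beta> (\<beta> x))}"
proof -
  have "k mod 9 < 9" by simp
  moreover have "k mod 9 \<noteq> 0" "k mod 9 \<noteq> 3" "k mod 9 \<noteq> 6" using k by presburger+
  ultimately consider "k mod 9 \<in> {1, 8}" | "k mod 9 \<in> {4, 5}" | "k mod 9 \<in> {7, 2}"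
    using less_9_cases[of "k mod 9"] by auto
  then show ?thesis
  proof cases
    case 1
    then have "u \<in> wt 1 1 \<union> wt 1 8"
      using wt_cast[OF u, of 1 1] wt_cast[OF u, of 8 1] by auto
    then show ?thesis by (rule that) auto
  next
    case 2
    then have "(7 * k) mod 9 = 1 \<or> (7 * k) mod 9 = 8" by (auto simp flip: mod_mult_right_eq[of 7 k])
    then have "(\<lambda>x. u (\<beta> (\<beta> x))) \<in> wt 1 1 \<union> wt 1 8"
      using wt_cast[OF wt_\<beta>\<beta>[OF u], of 1 1] wt_cast[OF wt_\<beta>\<beta>[OF u], of 8 1] by auto
    then show ?thesis by (rule that) auto
  next
    case 3
    then have "(4 * k) mod 9 = 1 \<or> (4 * k) mod 9 = 8" by (auto simp flip: mod_mult_right_eq[of 4 k])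
    then have "(\<lambda>x. u (\<beta> x)) \<in> wt 1 1 \<union> wt 1 8"
      using wt_cast[OF wt_\<beta>[OF u], of 1 1] wt_cast[OF wt_\<beta>[OF u], of 8 1] by auto
    then show ?thesis by (rule that) auto
  qed
qed

text \<open>A monomial in t and its translates has the same nonzero value at all six points, so it
  can cancel the weight of any F of degree at most 7 without affecting the comparison
  (\<open>key\<close>). What remains to be separated is the action of the group of order 3 generated
  by \<beta>, and the forms of weight prime to 3 are already fixed by it.\<close>

lemma conn_if_fixed:
  assumes tr: "same_traces v w" and X: "v \<in> X" "w \<in> X" and t: "t \<in> wt 1 1" and c: "c \<noteq> 0"
    and tv: "t v = c" "t (\<beta> v) = c" "t (\<beta> (\<beta> v)) = c"
    and tw: "t w = c" "t (\<beta> w) = c" "t (\<beta> (\<beta> w)) = c"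
    and fix_v: "\<And>k u. u \<in> wt 1 k \<Longrightarrow> k mod 3 \<noteq> 0 \<Longrightarrow> u (\<beta> v) = u v \<and> u (\<beta> (\<beta> v)) = u v"
    and fix_w: "\<And>k u. u \<in> wt 1 k \<Longrightarrow> k mod 3 \<noteq> 0 \<Longrightarrow> u (\<beta> w) = u w \<and> u (\<beta> (\<beta> w)) = u w"
  shows "conn v w"
proof -
  have key: "F v + F (\<beta> v) + F (\<beta> (\<beta> v)) = F w + F (\<beta> w) + F (\<beta> (\<beta> w))"
    if F: "F \<in> wt d k" and d: "d \<le> 7" for F d k
  proof -
    obtain i j l where ijl: "i + j + l \<le> 3" "(k mod 9 + (i + 4 * j + 7 * l)) mod 9 = 0"
      using exponents_3[of "k mod 9"] by auto
    let ?m = "\<lambda>x. t x ^ i * t (\<beta> x) ^ j * t (\<beta> (\<beta> x)) ^ l"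
    have "(\<lambda>x. F x * ?m x) \<in> wt 10 0"
      using d ijl by (intro wt_cast[OF wt_mult[OF F wt_monomial[OF t, of i j l]]])
        (auto simp: mult.commute mod_simps)
    from same_tracesD[OF tr this]
    have "(F v + F (\<beta> v) + F (\<beta> (\<beta> v))) * c ^ (i + j + l) = (F w + F (\<beta> w) + F (\<beta> (\<beta> w))) * c ^ (i + j + l)"
      using X by (simp add: tv tw power_add algebra_simps)
    then show ?thesis using c by simp
  qed
  have unit: "u v = u w" if u: "u \<in> wt 1 k" "k mod 3 \<noteq> 0" for u k
  proof -
    have "u v + u v + u v = u w + u w + u w" using key[OF u(1)] fix_v[OF u] fix_w[OF u] by simp
    then have "3 * u v = 3 * u w" by simp
    then show ?thesis by (subst (asm) mult_cancel_left) simp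
  qed
  have inv: "F v' = F w" if F: "F \<in> bwt d i j" "j mod 3 = 0" "d \<le> 7" and v': "v' \<in> {v, \<beta> v, \<beta> (\<beta> v)}"
    for F d i j v'
  proof -
    have "\<zeta> ^ (3 * j) = 1" using F(2) \<zeta>_eq_1_iff three_mod_9 by simp
    then have \<beta>: "F (\<beta> x) = F x" if "x \<in> X" for x using bwt_\<beta>[OF F(1) that] by simp
    have "3 * F v = 3 * F w" using key[OF bwt_wt[OF F(1)] F(3)] X by (simp add: \<beta>)
    then have "F v = F w" by (subst (asm) mult_cancel_left) simp
    then show ?thesis using v' X by (auto simp: \<beta>)
  qed
  have ex: "\<exists>v'\<in>{v, \<beta> v, \<beta> (\<beta> v)}. v' = w"
  proof (cases "\<exists>u i j. i < 3 \<and> j < 3 \<and> j \<noteq> 0 \<and> u \<in> bwt 1 i j \<and> u v \<noteq> 0")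
    case False
    have "v = w"
    proof (rule bi_weights_separate[OF X unit])
      fix i j u assume ij: "i < (3::nat)" "j < (3::nat)" and u: "u \<in> bwt 1 i j"
      show "u v = u w"
      proof (cases "j = 0")
        case True
        then show ?thesis using inv[OF u, of v] by simp
      next
        case j: False
        have "u v ^ 3 = u w ^ 3" using inv[OF bwt_power[OF u, of 3], of v] by simp
        moreover have "u v = 0" using False ij j u by blast
        ultimately show ?thesis by simp
      qed
    qed
    then show ?thesis by simp
  next
    case True
    then obtain u0 i0 j0 where u0: "j0 < 3" "j0 \<noteq> 0" "u0 \<in> bwt 1 i0 j0" "u0 v \<noteq> 0" by blast
    have j0: "j0 = 1 \<or> j0 = 2" using u0(1,2) by linarith
    have cubes: "u0 v ^ 3 = u0 w ^ 3" using inv[OF bwt_power[OF u0(3), of 3], of v] by simp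
    then have "(u0 w / u0 v) ^ 3 = 1" using u0(4) by (simp add: power_divide flip: cubes)
    then obtain r where r: "u0 w / u0 v = \<zeta> ^ (3 * r)" using root_3 by blast
    \<comment> \<open>Modulo 3 the nonzero class \<open>j0\<close> is its own inverse, so \<beta>^l
      multiplies \<open>u0\<close> by exactly \<zeta>^(3 r).\<close>
    define l where "l = (j0 * r) mod 3"
    define v' where "v' = (\<beta> ^^ l) v"
    have "l < 3" by (simp add: l_def)
    then have "l = 0 \<or> l = 1 \<or> l = 2" by linarith
    then have v': "v' \<in> {v, \<beta> v, \<beta> (\<beta> v)}" by (auto simp: v'_def numeral_2_eq_2)
    have v'X: "v' \<in> X" using v' X by auto
    have "u0 v' = \<zeta> ^ (3 * (j0 * l)) * u0 v" using bwt_action[OF u0(3) X(1), of 0 l] by (simp add: v'_def)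
    also have "\<zeta> ^ (3 * (j0 * l)) = \<zeta> ^ (3 * r)"
    proof -
      have "2 * (2 * r) mod 3 = (r + r * 3) mod 3" by simp
      then have "2 * ((2 * r) mod 3) mod 3 = r mod 3" by (simp only: mod_mult_right_eq mod_mult_self1)
      then have "(j0 * l) mod 3 = r mod 3" using j0 unfolding l_def by (elim disjE) simp_all
      then have "3 * (j0 * l) mod 9 = 3 * r mod 9" 
        using mult_mod_right[of 3 "j0 * l" 3] mult_mod_right[of 3 r 3] by simp
      then show ?thesis using \<zeta>_mod[of "3 * (j0 * l)"] \<zeta>_mod[of "3 * r"] by simp
    qed
    finally have u0w: "u0 v' = u0 w" using u0(4) r by (simp add: field_simps)
    then have nz: "u0 w \<noteq> 0" using cubes u0(4) by auto
    have u1: "u v' = u w" if k: "k mod 3 \<noteq> 0" and u: "u \<in> wt 1 k" for k u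
    proof -
      have "u v' = u v" using fix_v[OF u k] v' by (elim insertE emptyE) simp_all
      then show ?thesis using unit[OF u k] by simp
    qed
    have u2: "u v' = u w" if ij: "i < 3" "j < 3" and u: "u \<in> bwt 1 i j" for i j u
    proof -
      have "j = 0 \<or> j = 1 \<or> j = 2" using ij(2) by linarith
      \<comment> \<open>The exponent is - j / j0 modulo 3; it makes u times a power of
        \<open>u0\<close> invariant under \<beta>.\<close>
      then have "(j + (2 * j * j0) mod 3 * j0) mod 3 = 0" using j0 by (elim disjE) simp_all
      then obtain e where ej: "(j + e * j0) mod 3 = 0" and "e < 3" by auto
      then have e: "e \<le> 2" by linarith
      have "1 + e * 1 \<le> 7" using e by simp
      from inv[OF bwt_mult[OF u bwt_power[OF u0(3), of e]] ej this v']
      have "u v' * u0 v' ^ e = u w * u0 w ^ e" .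
      then show ?thesis using nz u0w by simp
    qed
    have "v' = w" by (rule bi_weights_separate[OF v'X X(2) u1 u2])
    then show ?thesis using v' by blast
  qed
  have "conn v (\<beta> v)" "conn v (\<beta> (\<beta> v))" 
    using X conn_\<beta>[of v] conn_\<beta>[of "\<beta> v"] by (auto intro: rtranclp_trans)
  then have "conn v v'" if "v' \<in> {v, \<beta> v, \<beta> (\<beta> v)}" for v' using that by blast
  then show ?thesis using ex by blast
qed

end

section \<open>Linear algebra for characters of C_3 x C_3\<close>

lemma independent_characters_mod_3:
  "\<forall>i0\<in>set [0,1,2::nat]. \<forall>j0\<in>set [0,1,2]. \<forall>i1\<in>set [0,1,2]. \<forall>j1\<in>set [0,1,2].
     (i0 * j1) mod 3 \<noteq> (j0 * i1) mod 3 \<longrightarrow> (\<forall>i\<in>set [0,1,2]. \<forall>j\<in>set [0,1,2].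
     \<exists>e\<in>set [0,1,2]. \<exists>f\<in>set [0,1,2]. (i + e * i0 + f * i1) mod 3 = 0 \<and> (j + e * j0 + f * j1) mod 3 = 0)"
  by code_simp

lemma dependent_characters_mod_3:
  "\<forall>i0\<in>set [0,1,2::nat]. \<forall>j0\<in>set [0,1,2]. \<forall>i\<in>set [0,1,2]. \<forall>j\<in>set [0,1,2].
     (i * j0) mod 3 = (j * i0) mod 3 \<longrightarrow> i0 \<noteq> 0 \<or> j0 \<noteq> 0 \<longrightarrow>
     (\<exists>e\<in>set [0,1,2]. (i + e * i0) mod 3 = 0 \<and> (j + e * j0) mod 3 = 0)"
  by code_simp

lemma less_3_iff: "(n::nat) < 3 \<longleftrightarrow> n \<in> set [0,1,2]"
  by auto

text \<open>A nonzero determinant means a basis of the plane over the field with three elements, so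
  the negative of (i, j) is a combination with coefficients below 3. The finitely many cases are
  checked by evaluation.\<close>

lemma independent_characters:
  fixes i0 j0 i1 j1 i j :: nat
  assumes "i0 < 3" "j0 < 3" "i1 < 3" "j1 < 3" "i < 3" "j < 3" "(i0 * j1) mod 3 \<noteq> (j0 * i1) mod 3"
  obtains e f where "e < 3" "f < 3" "(i + e * i0 + f * i1) mod 3 = 0" "(j + e * j0 + f * j1) mod 3 = 0"
  using independent_characters_mod_3[rule_format, of i0 j0 i1 j1 i j] assms unfolding less_3_iff by metis

text \<open>A vector of determinant zero with a nonzero vector is a multiple of it.\<close>

lemma dependent_characters:
  fixes i0 j0 i j :: nat
  assumes "i0 < 3" "j0 < 3" "i < 3" "j < 3" "(i * j0) mod 3 = (j * i0) mod 3" "i0 \<noteq> 0 \<or> j0 \<noteq> 0"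
  obtains e where "e < 3" "(i + e * i0) mod 3 = 0" "(j + e * j0) mod 3 = 0"
  using dependent_characters_mod_3[rule_format, of i0 j0 i j] assms unfolding less_3_iff by metis

context m27_action begin

lemma \<zeta>_3_cong:
  assumes "a mod 3 = b mod 3"
  shows "\<zeta> ^ (3 * a) = \<zeta> ^ (3 * b)"
proof -
  have "3 * a mod 9 = 3 * b mod 9"
    using mult_mod_right[of 3 a 3] mult_mod_right[of 3 b 3] assms by simp
  then show ?thesis using \<zeta>_mod[of "3 * a"] \<zeta>_mod[of "3 * b"] by simp
qed

text \<open>Only forms of weight prime to 3 detect \<alpha>^3. Where they vanish, \<alpha>^3 acts
  trivially and the action reduces to one of C_3 x C_3.\<close>

definition units_vanish :: "'x \<Rightarrow> bool" where
  "units_vanish v \<longleftrightarrow> (\<forall>k u. k mod 3 \<noteq> 0 \<longrightarrow> u \<in> wt 1 k \<longrightarrow> u v = 0)"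

lemma units_vanish_conn: "conn v w \<Longrightarrow> units_vanish v \<Longrightarrow> units_vanish w"
proof (induction rule: rtranclp_induct)
  case (step y z)
  then have y: "units_vanish y" "y \<in> X" by (auto simp: step_def)
  have 4: "(4 * k) mod 3 = k mod 3" for k :: nat
  proof -
    have "4 * k = k + k * 3" by simp
    then show ?thesis by (simp only: mod_mult_self1)
  qed
  show ?case unfolding units_vanish_def
  proof (intro allI impI)
    fix k u assume k: "k mod 3 \<noteq> (0::nat)" and u: "u \<in> wt 1 k"
    have "u y = 0" using y(1) k u unfolding units_vanish_def by blast
    moreover have "u (\<beta> y) = 0"
      using y(1)[unfolded units_vanish_def, rule_format, OF _ wt_\<beta>[OF u]] k by (simp only: 4) simp
    ultimately show "u z = 0" using step(2) wt_\<alpha>[OF u y(2)] by (auto simp: step_def)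
  qed
qed simp

text \<open>Characters are matched successively: one that is nonzero at v is aligned with w by a
  group element, then a second, independent one by an element in the kernel of the first. Any other
  value is recovered from products with powers of the aligned ones, of degree at most 5, or vanishes
  at both points because cubes are invariant.\<close>

lemma conn_if_units_vanish:
  assumes tr: "same_traces v w" and X: "v \<in> X" "w \<in> X" and van: "units_vanish v" "units_vanish w"
  shows "conn v w"
proof -
  have inv: "F v' = F w" if F: "F \<in> bwt d i j" "i mod 3 = 0" "j mod 3 = 0" "d \<le> 10" and v': "conn v v'"
    for F d i j v'
  proof -
    have "\<zeta> ^ (3 * j) = 1" using F(3) \<zeta>_eq_1_iff three_mod_9 by simp
    then have \<beta>: "F (\<beta> x) = F x" if "x \<in> X" for x using bwt_\<beta>[OF F(1) that] by simp
    have i: "(3 * i) mod 9 = 0" using F(2) three_mod_9 by simp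
    have v'X: "v' \<in> X" using conn_in[OF v' X(1)] .
    have "3 * F v' = 3 * F w"
      using same_tracesD[OF same_traces_conn'[OF v' tr] bwt_wt[OF F(1)] F(4) i] X v'X by (simp add: \<beta>)
    then show ?thesis by (subst (asm) mult_cancel_left) simp
  qed
  have zero: "u w = 0" if "u \<in> bwt 1 i j" "u v' = 0" "conn v v'" for u i j v'
    using inv[OF bwt_power[OF that(1), of 3] _ _ _ that(3)] that(2) by simp
  have ratio: "\<exists>r. u w = \<zeta> ^ (3 * r) * u v'" if "u \<in> bwt 1 i j" "u v' \<noteq> 0" "conn v v'" for u i j v'
  proof -
    have cubes: "u v' ^ 3 = u w ^ 3"
      using inv[OF bwt_power[OF that(1), of 3] _ _ _ that(3)] by simp
    have "(u w / u v') ^ 3 = 1" using that(2) by (simp add: power_divide flip: cubes)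
    then obtain r where "u w / u v' = \<zeta> ^ (3 * r)" using root_3 by blast
    then show ?thesis using that(2) by (intro exI[of _ r]) (simp add: field_simps)
  qed
  have fin: "conn v w" if v': "conn v v'" and
    bw: "\<And>i j u. i < 3 \<Longrightarrow> j < 3 \<Longrightarrow> u \<in> bwt 1 i j \<Longrightarrow> u v' = u w" for v'
  proof -
    have "u v' = u w" if "k mod 3 \<noteq> 0" "u \<in> wt 1 k" for k u
      using units_vanish_conn[OF v' van(1), unfolded units_vanish_def, rule_format, OF that]
        van(2)[unfolded units_vanish_def, rule_format, OF that] by simp
    then have "v' = w" by (rule bi_weights_separate[OF conn_in[OF v' X(1)] X(2) _ bw])
    with v' show ?thesis by simp
  qed
  have conn_act: "conn v ((\<alpha> ^^ p) ((\<beta> ^^ q) v'))" if "conn v v'" for v' p q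
    using that conn_in[OF that X(1)] conn_\<beta>_pow[of v' q] conn_\<alpha>_pow[of "(\<beta> ^^ q) v'" p]
    by (auto intro: rtranclp_trans)
  show ?thesis
  proof (cases "\<exists>u i j. i < 3 \<and> j < 3 \<and> (i \<noteq> 0 \<or> j \<noteq> 0) \<and> u \<in> bwt 1 i j \<and> u v \<noteq> 0")
    case False
    show ?thesis
    proof (rule fin)
      fix i j u assume ij: "i < (3::nat)" "j < (3::nat)" and u: "u \<in> bwt 1 i j"
      show "u v = u w"
      proof (cases "i = 0 \<and> j = 0")
        case True
        then show ?thesis using inv[OF u, of v] by simp
      next
        case 0: False
        have "u v = 0" using False ij 0 u by auto
        then show ?thesis using zero[OF u, of v] by simp
      qed
    qed simp
  next
    case True
    then obtain u0 i0 j0 where u0: "i0 < 3" "j0 < 3" "i0 \<noteq> 0 \<or> j0 \<noteq> 0" "u0 \<in> bwt 1 i0 j0" "u0 v \<noteq> 0"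
      by auto
    obtain r where r: "u0 w = \<zeta> ^ (3 * r) * u0 v" using ratio[OF u0(4,5)] by auto
    define r' where "r' = r mod 3"
    have "r' < 3" by (simp add: r'_def)
    obtain p q where pq: "(i0 * p + j0 * q) mod 3 = r mod 3"
    proof -
      \<comment> \<open>Squares of nonzero classes are 1 modulo 3, so one generator, raised to a
        suitable power, already produces r.\<close>
      have sq: "(n * (n * r)) mod 3 = r mod 3" if n: "n < 3" "n \<noteq> 0" for n
      proof -
        have "n = 1 \<or> n = 2" using n by linarith
        moreover have "2 * (2 * r) mod 3 = (r + r * 3) mod 3" by simp
        then have "2 * (2 * r) mod 3 = r mod 3" by (simp only: mod_mult_self1)
        ultimately show ?thesis by auto
      qed
      show thesis
      proof (cases "i0 = 0")
        case True
        then show ?thesis using that[of 0 "j0 * r"] sq[OF u0(2)] u0(3) by simp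
      next
        case False
        then show ?thesis using that[of "i0 * r" 0] sq[OF u0(1)] by simp
      qed
    qed
    define v1 where "v1 = (\<alpha> ^^ p) ((\<beta> ^^ q) v)"
    have v1: "conn v v1" unfolding v1_def by (rule conn_act) simp
    have v1X: "v1 \<in> X" using conn_in[OF v1 X(1)] .
    have e0: "u0 v1 = u0 w" unfolding v1_def bwt_action[OF u0(4) X(1)] r using \<zeta>_3_cong[OF pq] by simp
    have nz0: "u0 w \<noteq> 0" using r u0(5) \<zeta>_nz by simp
    show ?thesis
    proof (cases "\<exists>u i j. i < 3 \<and> j < 3 \<and> (i * j0) mod 3 \<noteq> (j * i0) mod 3 \<and> u \<in> bwt 1 i j \<and> u v1 \<noteq> 0")
      case False
      show ?thesis
      proof (rule fin[OF v1])
        fix i j u assume ij: "i < (3::nat)" "j < (3::nat)" and u: "u \<in> bwt 1 i j"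
        show "u v1 = u w"
        proof (cases "(i * j0) mod 3 = (j * i0) mod 3")
          case True
          obtain e where e: "e < 3" "(i + e * i0) mod 3 = 0" "(j + e * j0) mod 3 = 0"
            using dependent_characters[OF u0(1,2) ij True u0(3)] .
          have "1 + e * 1 \<le> 10" using e by simp
          from inv[OF bwt_mult[OF u bwt_power[OF u0(4), of e]] e(2,3) this v1]
          have "u v1 * u0 v1 ^ e = u w * u0 w ^ e" .
          then show ?thesis using nz0 e0 by simp
        next
          case 0: False
          have "u v1 = 0" using False ij 0 u by auto
          then show ?thesis using zero[OF u _ v1] by simp
        qed
      qed
    next
      case True
      then obtain u1 i1 j1 where u1: "i1 < 3" "j1 < 3" "(i1 * j0) mod 3 \<noteq> (j1 * i0) mod 3"
        "u1 \<in> bwt 1 i1 j1" "u1 v1 \<noteq> 0"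
        by auto
      have indep: "(i0 * j1) mod 3 \<noteq> (j0 * i1) mod 3" "(i0 * j1) mod 3 \<noteq> (i1 * j0) mod 3"
        using u1(3) by (simp_all add: mult.commute)
      obtain s where s: "u1 w = \<zeta> ^ (3 * s) * u1 v1" using ratio[OF u1(4,5) v1] by auto
      have lt: "(0::nat) < 3" "(2 * s) mod 3 < 3" by simp_all
      \<comment> \<open>The transposed linear system: the element must act trivially through the
        first character and by s through the second. The constant (2 * s) mod 3 stands for -
        s.\<close>
      obtain p1 q1 where "p1 < 3" "q1 < 3" and p1q1: "(0 + p1 * i0 + q1 * j0) mod 3 = 0" "((2 * s) mod 3 + p1 * i1 + q1 * j1) mod 3 = 0"
        using independent_characters[OF u0(1) u1(1) u0(2) u1(2) lt indep(2)] .
      have a0: "(i0 * p1 + j0 * q1) mod 3 = 0 mod 3" using p1q1(1) by (simp add: mult.commute)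
      have a1: "(i1 * p1 + j1 * q1) mod 3 = s mod 3"
      proof -
        have "i1 * p1 + j1 * q1 + s * 3 = 2 * s + (p1 * i1 + q1 * j1 + s)" by simp
        then have "(i1 * p1 + j1 * q1 + s * 3) mod 3 = ((2 * s) mod 3 + (p1 * i1 + q1 * j1 + s)) mod 3"
          by (simp only: mod_add_left_eq)
        also have "\<dots> = (((2 * s) mod 3 + p1 * i1 + q1 * j1) mod 3 + s) mod 3"
          by (simp only: mod_add_left_eq add.assoc)
        also have "\<dots> = s mod 3" unfolding p1q1(2) by simp
        finally show ?thesis by (simp only: mod_mult_self1)
      qed
      define v2 where "v2 = (\<alpha> ^^ p1) ((\<beta> ^^ q1) v1)"
      have v2: "conn v v2" unfolding v2_def by (rule conn_act[OF v1])
      have f0: "u0 v2 = u0 w" unfolding v2_def bwt_action[OF u0(4) v1X] using \<zeta>_3_cong[OF a0] e0 by simp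
      have f1: "u1 v2 = u1 w" unfolding v2_def bwt_action[OF u1(4) v1X] s using \<zeta>_3_cong[OF a1] by simp
      have nz1: "u1 w \<noteq> 0" using s u1(5) \<zeta>_nz by simp
      show ?thesis
      proof (rule fin[OF v2])
        fix i j u assume ij: "i < (3::nat)" "j < (3::nat)" and u: "u \<in> bwt 1 i j"
        obtain e f where ef: "e < 3" "f < 3" "(i + e * i0 + f * i1) mod 3 = 0" "(j + e * j0 + f * j1) mod 3 = 0"
          using independent_characters[OF u0(1,2) u1(1,2) ij indep(1)] .
        have "1 + e * 1 + f * 1 \<le> 10" using ef by simp
        from inv[OF bwt_mult[OF bwt_mult[OF u bwt_power[OF u0(4), of e]] bwt_power[OF u1(4), of f]] ef(3,4) this v2]
        have "u v2 * u0 v2 ^ e * u1 v2 ^ f = u w * u0 w ^ e * u1 w ^ f" .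
        then show "u v2 = u w" using nz0 nz1 f0 f1 by simp
      qed
    qed
  qed
qed

section \<open>Exchange of the weights 1 and 8\<close>

lemma inverse_action: "m27_action X \<alpha> \<beta> P (inverse \<zeta>)"
proof
  show "inverse \<zeta> ^ 9 = 1" using \<zeta>_9 by (simp add: power_inverse)
  show "inverse \<zeta> ^ m \<noteq> 1" if "0 < m" "m < 9" for m
    using \<zeta>_prim[OF that] by (simp add: power_inverse)
qed (fact \<alpha>_closed \<beta>_closed \<alpha>_9 \<beta>_3 \<beta>_\<alpha> P_const P_mono P_\<alpha> P_\<beta> | rule P_add P_mult P_separates; assumption)+

text \<open>As the inverse of \<zeta> is \<zeta>^8, weight 1 for the inverse root is weight 8 for
  \<zeta>, while weight 0 and hence \<open>same_traces\<close> do not change.\<close>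

lemma wt_inverse: "m27_action.wt X \<alpha> P (inverse \<zeta>) d k = wt d (8 * k)"
proof -
  have "\<zeta> * \<zeta> ^ 8 = 1" using \<zeta>_9 by (simp flip: power_Suc)
  then have "inverse \<zeta> = \<zeta> ^ 8" using \<zeta>_nz by (simp add: field_simps)
  then show ?thesis
    unfolding wt_def m27_action.wt_def[OF inverse_action] by (simp add: power_mult)
qed

lemma same_traces_inverse: "m27_action.same_traces X \<alpha> \<beta> P (inverse \<zeta>) = same_traces"
  by (intro ext) (simp add: same_traces_def m27_action.same_traces_def[OF inverse_action] wt_inverse)

lemma eigenvectors_if_not_conn:
  assumes tr: "same_traces v w" and X: "v \<in> X" "w \<in> X" and nc: "\<not> conn v w"
    and t: "t \<in> wt 1 1 \<union> wt 1 8" and z: "z \<in> {v, w}"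
  shows "\<exists>\<epsilon>. \<epsilon> ^ 3 = 1 \<and> t (\<beta> z) = \<epsilon> * t z \<and> t (\<beta> (\<beta> z)) = \<epsilon> ^ 2 * t z"
proof -
  have nc': "\<not> conn w v" using nc conn_sym by blast
  have tr': "same_traces w v" using tr by (rule same_traces_sym)
  show ?thesis
  proof (cases "t \<in> wt 1 1")
    case True
    then show ?thesis
      using z eigenvector_if_not_conn[OF tr X True nc] eigenvector_if_not_conn[OF tr' X(2,1) True nc'] by auto
  next
    case False
    then have t8: "t \<in> m27_action.wt X \<alpha> P (inverse \<zeta>) 1 1" using t by (simp add: wt_inverse)
    note ev = m27_action.eigenvector_if_not_conn[OF inverse_action, unfolded same_traces_inverse, OF _ _ _ t8]
    show ?thesis using z ev[OF tr X nc] ev[OF tr' X(2,1) nc'] by auto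
  qed
qed

text \<open>With \<epsilon> = \<zeta>^(3 a), the element \<alpha>^(2 a) contributes the exponents
  2a, 8a, 14a to the three coordinates and \<epsilon> contributes 0, 3a, 6a. The totals 2a, 11a, 20a
  agree modulo 9.\<close>

lemma align_eigenvector:
  assumes z: "z \<in> X" and t: "t \<in> wt 1 1" and \<epsilon>: "\<epsilon> ^ 3 = 1"
    and ev: "t (\<beta> z) = \<epsilon> * t z" "t (\<beta> (\<beta> z)) = \<epsilon> ^ 2 * t z"
  obtains z' where "conn z z'" "z' \<in> X" "t z = 0 \<longleftrightarrow> t z' = 0" "t (\<beta> z') = t z'" "t (\<beta> (\<beta> z')) = t z'"
proof -
  obtain a where a: "\<epsilon> = \<zeta> ^ (3 * a)" using root_3[OF \<epsilon>] by blast
  define z' where "z' = (\<alpha> ^^ (2 * a)) z"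
  have t0: "t z' = \<zeta> ^ (2 * a) * t z"
    unfolding z'_def using wt_\<alpha>_pow[OF t z] by simp
  have "t (\<beta> z') = \<zeta> ^ (4 * (2 * a)) * (\<epsilon> * t z)"
    unfolding z'_def ev[symmetric] using wt_\<alpha>_pow[OF wt_\<beta>[OF t] z] by simp
  also have "\<dots> = \<zeta> ^ (2 * a + a * 9) * t z" by (simp add: a flip: power_add)
  also have "\<dots> = t z'" unfolding t0 using \<zeta>_mod[of "2 * a + a * 9"] \<zeta>_mod[of "2 * a"] by (simp only: mod_mult_self1)
  finally have t1: "t (\<beta> z') = t z'" .
  have "t (\<beta> (\<beta> z')) = \<zeta> ^ (7 * (2 * a)) * (\<epsilon> ^ 2 * t z)"
    unfolding z'_def ev[symmetric] using wt_\<alpha>_pow[OF wt_\<beta>\<beta>[OF t] z] by simp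
  also have "\<dots> = \<zeta> ^ (2 * a + 2 * a * 9) * t z" by (simp add: a flip: power_add power_mult)
  also have "\<dots> = t z'" unfolding t0 using \<zeta>_mod[of "2 * a + 2 * a * 9"] \<zeta>_mod[of "2 * a"] by (simp only: mod_mult_self1)
  finally have t2: "t (\<beta> (\<beta> z')) = t z'" .
  show ?thesis
  proof (rule that[OF _ _ _ t1 t2])
    show "conn z z'" unfolding z'_def using z by (rule conn_\<alpha>_pow)
  qed (use z t0 \<zeta>_nz in \<open>simp_all add: z'_def\<close>)
qed

text \<open>The product t u is an \<alpha>-invariant of degree only 2 whose values along the
  \<beta>-orbit are in the ratio 1 : \<epsilon> : \<epsilon>^2. So \<open>level_set\<close> applies
  with room for the degree 4 that three nonzero coordinates require.\<close>

lemma conn_if_dual_eigenvector: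
  assumes tr: "same_traces v w" and X: "v \<in> X" "w \<in> X" and t: "t \<in> wt 1 1" and c: "t v \<noteq> 0"
    and tv: "t (\<beta> v) = t v" "t (\<beta> (\<beta> v)) = t v"
    and u: "u \<in> wt 1 8" "u v \<noteq> 0" and \<epsilon>: "\<epsilon> ^ 3 = 1" "\<epsilon> \<noteq> 1"
    and ev: "u (\<beta> v) = \<epsilon> * u v" "u (\<beta> (\<beta> v)) = \<epsilon> ^ 2 * u v"
  shows "conn v w"
proof -
  have "\<epsilon> ^ 2 \<noteq> 1" using \<epsilon> by (auto simp: power3_eq_cube power2_eq_square)
  have h: "(\<lambda>x. t x * u x) \<in> wt 2 0"
    by (rule wt_cast[OF wt_mult[OF t u(1)]]) simp_all
  obtain w' where w': "conn w w'" "w' \<in> X" "\<And>g e. g \<in> wt e 0 \<Longrightarrow> 2 * 2 + e \<le> 10 \<Longrightarrow> g v = g w'"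
  proof (rule level_set[OF tr X h])
    show "t v * u v \<noteq> t (\<beta> v) * u (\<beta> v)" "t v * u v \<noteq> t (\<beta> (\<beta> v)) * u (\<beta> (\<beta> v))"
      unfolding tv ev using c u(2) \<epsilon>(2) \<open>\<epsilon> ^ 2 \<noteq> 1\<close> by simp_all
  qed (simp, blast)
  have "\<forall>g\<in>wt 4 0. g v = g w'"
  proof
    fix g assume "g \<in> wt 4 0"
    then show "g v = g w'" by (rule w'(3)) simp
  qed
  then have "conn v w'" using conn_if_all_coordinates[OF X(1) w'(2) t] c tv by simp
  then show ?thesis using conn_sym[OF w'(1)] by (rule rtranclp_trans)
qed

text \<open>By contradiction: in each orbit a representative is chosen such that t has one common
  nonzero value on both \<beta>-orbits. There \<beta> fixes all forms of weight 1 by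
  \<open>eigenvalue_unique\<close>, all forms of weight 8 by
  \<open>conn_if_dual_eigenvector\<close>, hence all forms of weight prime to 3, and
  \<open>conn_if_fixed\<close> applies.\<close>

lemma conn_if_nonzero:
  assumes tr: "same_traces v w" and X: "v \<in> X" "w \<in> X" and t: "t \<in> wt 1 1" and c: "t v \<noteq> 0"
  shows "conn v w"
proof (rule ccontr)
  assume nc: "\<not> conn v w"
  have t18: "t \<in> wt 1 1 \<union> wt 1 8" using t by simp
  obtain v1 where v1: "conn v v1" "v1 \<in> X" "t v1 \<noteq> 0" "t (\<beta> v1) = t v1" "t (\<beta> (\<beta> v1)) = t v1"
  proof -
    obtain \<epsilon> where "\<epsilon> ^ 3 = 1" "t (\<beta> v) = \<epsilon> * t v" "t (\<beta> (\<beta> v)) = \<epsilon> ^ 2 * t v"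
      using eigenvectors_if_not_conn[OF tr X nc t18, of v] by auto
    from align_eigenvector[OF X(1) t this] that c show thesis by blast
  qed
  have "(\<lambda>x. t x ^ 2 * t (\<beta> (\<beta> x))) \<in> wt 3 0" using invariant_monomial[OF t, of 2 0 1 3] by simp
  note cubic = same_tracesD[OF _ this]
  have tr1: "same_traces v1 w" using same_traces_conn'[OF v1(1) tr] .
  obtain w1 where w1: "conn w w1" "w1 \<in> X" "t w1 \<noteq> 0" "t (\<beta> w1) = t w1" "t (\<beta> (\<beta> w1)) = t w1"
  proof -
    obtain \<epsilon> where ev: "\<epsilon> ^ 3 = 1" "t (\<beta> w) = \<epsilon> * t w" "t (\<beta> (\<beta> w)) = \<epsilon> ^ 2 * t w"
      using eigenvectors_if_not_conn[OF tr X nc t18, of w] by auto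
    have "t w \<noteq> 0"
    proof
      assume "t w = 0"
      then have "3 * t v1 ^ 3 = 0"
        using cubic[OF tr1] ev(2,3) v1 X by (simp add: power2_eq_square power3_eq_cube)
      then show False using v1(3) by simp
    qed
    with align_eigenvector[OF X(2) t ev] that show thesis by blast
  qed
  have tr11: "same_traces v1 w1" using same_traces_conn[OF w1(1) tr1] .
  have "3 * t v1 ^ 3 = 3 * t w1 ^ 3"
    using cubic[OF tr11] v1 w1 by (simp add: power2_eq_square power3_eq_cube mult.assoc)
  then have cubes: "t v1 ^ 3 = t w1 ^ 3" by (subst (asm) mult_cancel_left) simp
  have "(t w1 / t v1) ^ 3 = 1" using v1(3) by (simp add: power_divide flip: cubes)
  then obtain b where b: "t w1 / t v1 = \<zeta> ^ (3 * b)" using root_3 by blast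
  \<comment> \<open>Multiples of 3 are fixed by multiplication by 4 and by 7 modulo 9, so this
    element scales all three coordinates equally and keeps them equal.\<close>
  define v2 where "v2 = (\<alpha> ^^ (3 * b)) v1"
  have v2X: "v2 \<in> X" using v1(2) by (simp add: v2_def)
  have v2: "conn v1 v2" unfolding v2_def using v1(2) by (rule conn_\<alpha>_pow)
  have "t v2 = \<zeta> ^ (3 * b) * t v1" using wt_\<alpha>_pow[OF t v1(2)] by (simp add: v2_def)
  then have t0: "t v2 = t w1" using b v1(3) by (simp add: field_simps)
  have "t (\<beta> v2) = \<zeta> ^ (4 * (3 * b)) * t v1"
    using wt_\<alpha>_pow[OF wt_\<beta>[OF t] v1(2)] by (simp add: v2_def v1(4))
  also have "4 * (3 * b) = 3 * b + b * 9" by simp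
  also have "\<zeta> ^ (3 * b + b * 9) = \<zeta> ^ (3 * b)"
    using \<zeta>_mod[of "3 * b + b * 9"] \<zeta>_mod[of "3 * b"] by (simp only: mod_mult_self1)
  finally have t1: "t (\<beta> v2) = t w1" using b v1(3) by (simp add: field_simps)
  have "t (\<beta> (\<beta> v2)) = \<zeta> ^ (7 * (3 * b)) * t v1"
    using wt_\<alpha>_pow[OF wt_\<beta>\<beta>[OF t] v1(2)] by (simp add: v2_def v1(5))
  also have "7 * (3 * b) = 3 * b + 2 * b * 9" by simp
  also have "\<zeta> ^ (3 * b + 2 * b * 9) = \<zeta> ^ (3 * b)"
    using \<zeta>_mod[of "3 * b + 2 * b * 9"] \<zeta>_mod[of "3 * b"] by (simp only: mod_mult_self1)
  finally have t2: "t (\<beta> (\<beta> v2)) = t w1" using b v1(3) by (simp add: field_simps)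
  have tr2: "same_traces v2 w1" using same_traces_conn'[OF v2 tr11] .
  have nc2: "\<not> conn v2 w1"
    using nc rtranclp_trans[OF rtranclp_trans[OF v1(1) v2] rtranclp_trans[OF _ conn_sym[OF w1(1)]]] by blast
  then have nc2': "\<not> conn w1 v2" using conn_sym by blast
  have ev2: "\<exists>\<epsilon>. \<epsilon> ^ 3 = 1 \<and> f (\<beta> z) = \<epsilon> * f z \<and> f (\<beta> (\<beta> z)) = \<epsilon> ^ 2 * f z"
    if "f \<in> wt 1 1 \<union> wt 1 8" "z \<in> {v2, w1}" for f z
    using eigenvectors_if_not_conn[OF tr2 v2X w1(2) nc2 that] .
  have fix1: "f (\<beta> z) = f z \<and> f (\<beta> (\<beta> z)) = f z" if f: "f \<in> wt 1 1" and z: "z \<in> {v2, w1}" for f z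
  proof (cases "f z = 0")
    case True
    then show ?thesis using ev2[of f z] f z by auto
  next
    case False
    have tz: "t z \<noteq> 0" "t (\<beta> z) = 1 * t z" "t (\<beta> (\<beta> z)) = 1 ^ 2 * t z"
      using z t0 t1 t2 w1(3,4,5) by auto
    obtain \<epsilon> where \<epsilon>: "f (\<beta> z) = \<epsilon> * f z" "f (\<beta> (\<beta> z)) = \<epsilon> ^ 2 * f z"
      using ev2[of f z] f z by auto
    have "(\<lambda>x. f x + t x) \<in> wt 1 1 \<union> wt 1 8" using wt_add[OF f t] by simp
    from ev2[OF this z] obtain \<gamma> where "f (\<beta> z) + t (\<beta> z) = \<gamma> * (f z + t z)"
      "f (\<beta> (\<beta> z)) + t (\<beta> (\<beta> z)) = \<gamma> ^ 2 * (f z + t z)" by auto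
    then have "\<epsilon> = 1" unfolding \<epsilon> tz(2,3) by (rule eigenvalue_unique[OF False tz(1)])
    then show ?thesis using \<epsilon> by simp
  qed
  have fix8: "f (\<beta> z) = f z \<and> f (\<beta> (\<beta> z)) = f z" if f: "f \<in> wt 1 8" and z: "z \<in> {v2, w1}" for f z
  proof -
    obtain \<epsilon> where \<epsilon>: "\<epsilon> ^ 3 = 1" "f (\<beta> z) = \<epsilon> * f z" "f (\<beta> (\<beta> z)) = \<epsilon> ^ 2 * f z"
      using ev2[of f z] f z by auto
    show ?thesis
    proof (rule ccontr)
      assume "\<not> ?thesis"
      then have 1: "f z \<noteq> 0" "\<epsilon> \<noteq> 1" using \<epsilon> by auto
      show False
      proof (cases "z = v2")
        case True
        then show False
          using conn_if_dual_eigenvector[OF tr2 v2X w1(2) t _ _ _ f _ \<epsilon>(1)] 1 \<epsilon> t0 t1 t2 w1(3) nc2 by simp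
      next
        case False
        then show False
          using conn_if_dual_eigenvector[OF same_traces_sym[OF tr2] w1(2) v2X t _ _ _ f _ \<epsilon>(1)] 1 \<epsilon> w1(3-5) z nc2'
          by simp
      qed
    qed
  qed
  have fixed: "u (\<beta> z) = u z \<and> u (\<beta> (\<beta> z)) = u z"
    if u: "u \<in> wt 1 k" "k mod 3 \<noteq> 0" and z: "z \<in> {v2, w1}" for u k z
  proof -
    have zX: "z \<in> X" using z v2X w1(2) by auto
    obtain f where f: "f \<in> wt 1 1 \<union> wt 1 8" "u z \<in> {f z, f (\<beta> z), f (\<beta> (\<beta> z))}"
      "u (\<beta> z) \<in> {f z, f (\<beta> z), f (\<beta> (\<beta> z))}" "u (\<beta> (\<beta> z)) \<in> {f z, f (\<beta> z), f (\<beta> (\<beta> z))}"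
      using unit_weight_shift[OF u] zX by metis
    have "f (\<beta> z) = f z \<and> f (\<beta> (\<beta> z)) = f z" using f(1) fix1[OF _ z] fix8[OF _ z] by auto
    then show ?thesis using f(2-4) by auto
  qed
  have "conn v2 w1"
    using fixed by (intro conn_if_fixed[OF tr2 v2X w1(2) t w1(3) t0 t1 t2 HOL.refl w1(4,5)]) auto
  then show False using nc2 by simp
qed

theorem conn_if_same_traces:
  assumes tr: "same_traces v w" and X: "v \<in> X" "w \<in> X"
  shows "conn v w"
proof (rule ccontr)
  assume nc: "\<not> conn v w"
  then have nc': "\<not> conn w v" using conn_sym by blast
  have tr': "same_traces w v" using tr by (rule same_traces_sym)
  have van1: "t z = 0" if t: "t \<in> wt 1 1 \<union> wt 1 8" and z: "z \<in> {v, w}" for t z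
  proof (cases "t \<in> wt 1 1")
    case True
    then show ?thesis using conn_if_nonzero[OF tr X True] conn_if_nonzero[OF tr' X(2,1) True] nc nc' z by auto
  next
    case False
    then have t8: "t \<in> m27_action.wt X \<alpha> P (inverse \<zeta>) 1 1" using t by (simp add: wt_inverse)
    note nz = m27_action.conn_if_nonzero[OF inverse_action, unfolded same_traces_inverse, OF _ _ _ t8]
    show ?thesis using nz[OF tr X] nz[OF tr' X(2,1)] nc nc' z by auto
  qed
  have "units_vanish z" if z: "z \<in> {v, w}" for z
    unfolding units_vanish_def
  proof (intro allI impI)
    fix k u assume k: "k mod 3 \<noteq> (0::nat)" and u: "u \<in> wt 1 k"
    have zX: "z \<in> X" using z X by auto
    obtain f where f: "f \<in> wt 1 1 \<union> wt 1 8" "u z \<in> {f z, f (\<beta> z), f (\<beta> (\<beta> z))}"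
      using unit_weight_shift[OF u k] zX by metis
    have "f z = 0" using van1[OF f(1) z] .
    then have "f (\<beta> z) = 0" "f (\<beta> (\<beta> z)) = 0" using eigenvectors_if_not_conn[OF tr X nc f(1) z] by auto
    then show "u z = 0" using f(2) \<open>f z = 0\<close> by auto
  qed
  then show False using conn_if_units_vanish[OF tr X] nc by simp
qed

end

section \<open>Polynomials as functions\<close>

definition monomial_value :: "'k vec \<Rightarrow> (nat \<Rightarrow>\<^sub>0 nat) \<Rightarrow> 'k::field" where
  "monomial_value v m = (\<Prod>i\<in>Poly_Mapping.keys m. (v $ i) ^ Poly_Mapping.lookup m i)"

lemma monomial_value_superset:
  assumes "finite I" "Poly_Mapping.keys m \<subseteq> I"
  shows "monomial_value v m = (\<Prod>i\<in>I. (v $ i) ^ Poly_Mapping.lookup m i)"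
  unfolding monomial_value_def using assms
  by (intro prod.mono_neutral_left) (auto simp: in_keys_iff)

lemma monomial_value_add: "monomial_value v (m + m') = monomial_value v m * monomial_value v m'"
proof -
  let ?I = "Poly_Mapping.keys m \<union> Poly_Mapping.keys m'"
  have "Poly_Mapping.keys (m + m') \<subseteq> ?I" by (rule keys_add)
  then show ?thesis
    by (simp add: monomial_value_superset[of ?I] lookup_add power_add prod.distrib)
qed

lemma eval_superset:
  assumes "finite S" "Poly_Mapping.keys f \<subseteq> S"
  shows "eval v f = (\<Sum>m\<in>S. Poly_Mapping.lookup f m * monomial_value v m)"
  unfolding eval_def monomial_value_def[symmetric] using assms
  by (intro sum.mono_neutral_left) (auto simp: in_keys_iff)

lemma eval_add: "eval v (f + g) = eval v f + eval v g"
proof -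
  let ?S = "Poly_Mapping.keys f \<union> Poly_Mapping.keys g"
  have "Poly_Mapping.keys (f + g) \<subseteq> ?S" by (rule keys_add)
  then show ?thesis
    by (simp add: eval_superset[of ?S] lookup_add distrib_right sum.distrib)
qed

lemma eval_zero: "eval v 0 = 0"
  by (simp add: eval_def)

lemma eval_sum: "eval v (sum F A) = (\<Sum>a\<in>A. eval v (F a))"
  by (induction A rule: infinite_finite_induct) (auto simp: eval_add eval_zero)

lemma eval_single: "eval v (Poly_Mapping.single m c) = c * monomial_value v m"
  by (simp add: eval_def monomial_value_def)

lemma sum_singles: "f = (\<Sum>m\<in>Poly_Mapping.keys f. Poly_Mapping.single m (Poly_Mapping.lookup f m))"
proof (rule poly_mapping_eqI)
  fix k
  show "Poly_Mapping.lookup f k =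
    Poly_Mapping.lookup (\<Sum>m\<in>Poly_Mapping.keys f. Poly_Mapping.single m (Poly_Mapping.lookup f m)) k"
    by (cases "k \<in> Poly_Mapping.keys f")
      (auto simp: lookup_sum lookup_single when_def in_keys_iff)
qed

lemma eval_mult: "eval v (f * g) = eval v f * eval v g"
proof -
  let ?s = "\<lambda>f m. Poly_Mapping.single m (Poly_Mapping.lookup f m)"
  have "f * g = (\<Sum>m\<in>Poly_Mapping.keys f. ?s f m) * (\<Sum>m\<in>Poly_Mapping.keys g. ?s g m)"
    by (simp flip: sum_singles)
  also have "\<dots> = (\<Sum>m\<in>Poly_Mapping.keys f. \<Sum>m'\<in>Poly_Mapping.keys g. ?s f m * ?s g m')"
    by (rule sum_product)
  finally have "eval v (f * g) = (\<Sum>m\<in>Poly_Mapping.keys f. \<Sum>m'\<in>Poly_Mapping.keys g.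
      (Poly_Mapping.lookup f m * monomial_value v m) * (Poly_Mapping.lookup g m' * monomial_value v m'))"
    by (simp add: eval_sum mult_single eval_single monomial_value_add algebra_simps)
  also have "\<dots> = eval v f * eval v g"
    by (simp add: sum_product eval_def monomial_value_def)
  finally show ?thesis .
qed

lemma eval_const: "eval v (const c) = c"
  by (simp add: const_def eval_single monomial_value_def)

lemma eval_var: "eval v (var i) = v $ i"
  by (simp add: var_def eval_single monomial_value_def)

lemma eval_one: "eval v 1 = 1"
  by (simp add: eval_def)

lemma eval_power: "eval v (f ^ k) = eval v f ^ k"
  by (induction k) (auto simp: eval_mult eval_one)

lemma eval_prod: "eval v (prod F A) = (\<Prod>a\<in>A. eval v (F a))"
  by (induction A rule: infinite_finite_induct) (auto simp: eval_mult eval_one)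

lemma eval_subst:
  assumes "f \<in> polys n" "\<And>i. i < n \<Longrightarrow> eval v (\<sigma> i) = w $ i"
  shows "eval v (subst \<sigma> f) = eval w f"
proof -
  have "(\<Prod>i\<in>Poly_Mapping.keys m. eval v (\<sigma> i) ^ Poly_Mapping.lookup m i) =
      (\<Prod>i\<in>Poly_Mapping.keys m. (w $ i) ^ Poly_Mapping.lookup m i)" if "m \<in> Poly_Mapping.keys f" for m
  proof (rule prod.cong)
    fix i assume "i \<in> Poly_Mapping.keys m"
    then have "i < n" using assms(1) that by (auto simp: polys_def)
    then show "eval v (\<sigma> i) ^ Poly_Mapping.lookup m i = (w $ i) ^ Poly_Mapping.lookup m i"
      using assms(2) by simp
  qed simp
  then show ?thesis
    unfolding subst_def eval_sum eval_mult eval_const eval_prod eval_power eval_def[of w]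
    by (intro sum.cong) auto
qed

lemma polys_add: "f \<in> polys n \<Longrightarrow> g \<in> polys n \<Longrightarrow> f + g \<in> polys n"
  using keys_add[of f g] by (auto simp: polys_def)

lemma polys_mult:
  assumes "f \<in> polys n" "g \<in> polys n"
  shows "f * g \<in> polys n"
  unfolding polys_def
proof (intro CollectI ballI)
  fix m assume "m \<in> Poly_Mapping.keys (f * g)"
  then obtain a b where "m = a + b" "a \<in> Poly_Mapping.keys f" "b \<in> Poly_Mapping.keys g"
    using keys_mult[of f g] by blast
  then show "Poly_Mapping.keys m \<subseteq> {..<n}"
    using assms keys_add[of a b] unfolding polys_def by blast
qed

lemma polys_const: "const c \<in> polys n"
  by (simp add: polys_def const_def)

lemma polys_var: "i < n \<Longrightarrow> var i \<in> polys n"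
  by (simp add: polys_def var_def)

lemma polys_one: "1 \<in> polys n"
  by (simp add: polys_def)

lemma polys_zero: "0 \<in> polys n"
  by (simp add: polys_def)

lemma polys_sum: "(\<And>a. a \<in> A \<Longrightarrow> F a \<in> polys n) \<Longrightarrow> sum F A \<in> polys n"
  by (induction A rule: infinite_finite_induct) (auto intro: polys_add simp: polys_zero)

lemma polys_power: "f \<in> polys n \<Longrightarrow> f ^ k \<in> polys n"
  by (induction k) (auto intro: polys_mult polys_one)

lemma polys_prod: "(\<And>a. a \<in> A \<Longrightarrow> F a \<in> polys n) \<Longrightarrow> prod F A \<in> polys n"
  by (induction A rule: infinite_finite_induct) (auto intro: polys_mult polys_one)

lemma polys_subst:
  assumes "f \<in> polys n" "\<And>i. i < n \<Longrightarrow> \<sigma> i \<in> polys n"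
  shows "subst \<sigma> f \<in> polys n"
  unfolding subst_def using assms
  by (intro polys_sum polys_mult polys_const polys_prod polys_power) (auto simp: polys_def)

definition monomial_degree :: "(nat \<Rightarrow>\<^sub>0 nat) \<Rightarrow> nat" where
  "monomial_degree m = (\<Sum>i\<in>Poly_Mapping.keys m. Poly_Mapping.lookup m i)"

lemma monomial_degree_superset:
  assumes "finite I" "Poly_Mapping.keys m \<subseteq> I"
  shows "monomial_degree m = (\<Sum>i\<in>I. Poly_Mapping.lookup m i)"
  unfolding monomial_degree_def using assms
  by (intro sum.mono_neutral_left) (auto simp: in_keys_iff)

lemma monomial_degree_add: "monomial_degree (m + m') = monomial_degree m + monomial_degree m'"
proof -
  let ?I = "Poly_Mapping.keys m \<union> Poly_Mapping.keys m'"
  have "Poly_Mapping.keys (m + m') \<subseteq> ?I" by (rule keys_add)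
  then show ?thesis
    by (simp add: monomial_degree_superset[of ?I] lookup_add sum.distrib)
qed

lemma degree_at_most_iff: "degree_at_most d f \<longleftrightarrow> (\<forall>m\<in>Poly_Mapping.keys f. monomial_degree m \<le> d)"
  by (simp add: degree_at_most_def monomial_degree_def)

lemma degree_at_most_add: "degree_at_most d f \<Longrightarrow> degree_at_most d g \<Longrightarrow> degree_at_most d (f + g)"
  using keys_add[of f g] by (auto simp: degree_at_most_iff)

lemma degree_at_most_mult:
  assumes "degree_at_most d f" "degree_at_most e g"
  shows "degree_at_most (d + e) (f * g)"
  unfolding degree_at_most_iff
proof
  fix m assume "m \<in> Poly_Mapping.keys (f * g)"
  then obtain a b where "m = a + b" "a \<in> Poly_Mapping.keys f" "b \<in> Poly_Mapping.keys g"
    using keys_mult[of f g] by blast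
  then show "monomial_degree m \<le> d + e"
    using assms unfolding degree_at_most_iff by (auto simp: monomial_degree_add intro: add_mono)
qed

lemma degree_at_most_mono: "degree_at_most d f \<Longrightarrow> d \<le> e \<Longrightarrow> degree_at_most e f"
  by (auto simp: degree_at_most_iff)

lemma degree_at_most_const: "degree_at_most 0 (const c)"
  by (simp add: degree_at_most_def const_def)

lemma degree_at_most_var: "degree_at_most 1 (var i)"
  by (simp add: degree_at_most_def var_def)

text \<open>Induction on the number of variables: as a polynomial in the last variable the sum
  vanishes on an infinite field, so each of its coefficients is zero, and the monomials contributing
  to one coefficient differ in an earlier variable.\<close>

lemma monomial_functions_independent:
  fixes c :: "'a \<Rightarrow> 'k::field_char_0" and e :: "'a \<Rightarrow> nat \<Rightarrow> nat"
  assumes "finite S" "\<And>m m'. m \<in> S \<Longrightarrow> m' \<in> S \<Longrightarrow> m \<noteq> m' \<Longrightarrow> \<exists>i<n. e m i \<noteq> e m' i"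
    and "\<And>x. (\<Sum>m\<in>S. c m * (\<Prod>i<n. x i ^ e m i)) = 0" and "m \<in> S"
  shows "c m = 0"
  using assms
proof (induction n arbitrary: S m)
  case 0
  then have "S = {m}" by blast
  then show ?case using 0(3) by simp
next
  case (Suc n)
  let ?S = "{m' \<in> S. e m' n = e m n}"
  have "(\<Sum>m'\<in>?S. c m' * (\<Prod>i<n. x i ^ e m' i)) = 0" for x
  proof -
    define p where "p = (\<Sum>m\<in>S. monom (c m * (\<Prod>i<n. x i ^ e m i)) (e m n))"
    have "poly p t = 0" for t
    proof -
      have "c m * (\<Prod>i<Suc n. (x(n := t)) i ^ e m i) = c m * (\<Prod>i<n. x i ^ e m i) * t ^ e m n" for m
        by simp
      then show ?thesis using Suc.prems(3)[of "x(n := t)"] unfolding p_def by (simp add: poly_sum poly_monom mult.assoc)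
    qed
    then have "p = 0" using poly_all_0_iff_0 by blast
    then have "coeff p (e m n) = 0" by simp
    then have "(\<Sum>m'\<in>S. if e m' n = e m n then c m' * (\<Prod>i<n. x i ^ e m' i) else 0) = 0"
      unfolding p_def by (simp add: coeff_sum)
    then show ?thesis using Suc.prems(1) by (simp add: sum.inter_filter)
  qed
  moreover have "\<exists>i<n. e a i \<noteq> e b i" if "a \<in> ?S" "b \<in> ?S" "a \<noteq> b" for a b
    using Suc.prems(2)[of a b] that by (auto simp: less_Suc_eq)
  ultimately show ?case using Suc.IH[of ?S m] Suc.prems(1,4) by simp
qed

text \<open>Lets the formal identity in the definition of invariants be checked on values.\<close>

lemma eval_eq_imp_eq:
  fixes f g :: "'k::field_char_0 mpoly"
  assumes f: "f \<in> polys n" and g: "g \<in> polys n" and eq: "\<And>v. v \<in> carrier_vec n \<Longrightarrow> eval v f = eval v g"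
  shows "f = g"
proof (rule poly_mapping_eqI)
  fix k
  let ?S = "Poly_Mapping.keys f \<union> Poly_Mapping.keys g"
  let ?c = "\<lambda>m. Poly_Mapping.lookup f m - Poly_Mapping.lookup g m"
  have sub: "Poly_Mapping.keys m \<subseteq> {..<n}" if "m \<in> ?S" for m
    using f g that by (auto simp: polys_def)
  show "Poly_Mapping.lookup f k = Poly_Mapping.lookup g k"
  proof (cases "k \<in> ?S")
    case True
    have "?c k = 0"
    proof (rule monomial_functions_independent[of ?S n "Poly_Mapping.lookup" ?c])
      fix m m' assume m: "m \<in> ?S" "m' \<in> ?S" "m \<noteq> m'"
      then obtain i where "Poly_Mapping.lookup m i \<noteq> Poly_Mapping.lookup m' i"
        by (meson poly_mapping_eqI)
      then have "i \<in> Poly_Mapping.keys m \<union> Poly_Mapping.keys m'" by (auto simp: in_keys_iff)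
      then show "\<exists>i<n. Poly_Mapping.lookup m i \<noteq> Poly_Mapping.lookup m' i"
        using sub[OF m(1)] sub[OF m(2)] \<open>Poly_Mapping.lookup m i \<noteq> _\<close> by blast
    next
      fix x :: "nat \<Rightarrow> 'k"
      let ?v = "vec n x"
      have "(\<Sum>m\<in>?S. ?c m * (\<Prod>i<n. x i ^ Poly_Mapping.lookup m i)) =
          (\<Sum>m\<in>?S. ?c m * monomial_value ?v m)"
        using sub by (intro sum.cong) (auto simp: monomial_value_superset[of "{..<n}"])
      also have "\<dots> = eval ?v f - eval ?v g"
        by (simp add: eval_superset[of ?S] left_diff_distrib sum_subtractf)
      finally show "(\<Sum>m\<in>?S. ?c m * (\<Prod>i<n. x i ^ Poly_Mapping.lookup m i)) = 0"
        using eq[of ?v] by simp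
    qed (use True in auto)
    then show ?thesis by simp
  qed (auto simp: in_keys_iff)
qed

section \<open>Matrix representations and the upper bound\<close>

text \<open>The filtration that instantiates \<open>m27_action\<close>. The rule \<open>cong\<close>
  is there because the coordinate formula for a matrix-vector product holds only on
  \<open>carrier_vec n\<close>.\<close>

inductive_set poly_fun :: "nat \<Rightarrow> (nat \<times> ('k::field vec \<Rightarrow> 'k)) set" for n where
  const: "(0, \<lambda>_. c) \<in> poly_fun n"
| coordinate: "i < n \<Longrightarrow> (1, \<lambda>x. x $ i) \<in> poly_fun n"
| add: "(d, f) \<in> poly_fun n \<Longrightarrow> (d, g) \<in> poly_fun n \<Longrightarrow> (d, \<lambda>x. f x + g x) \<in> poly_fun n"
| mult: "(d, f) \<in> poly_fun n \<Longrightarrow> (e, g) \<in> poly_fun n \<Longrightarrow> (d + e, \<lambda>x. f x * g x) \<in> poly_fun n"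
| mono: "(d, f) \<in> poly_fun n \<Longrightarrow> d \<le> e \<Longrightarrow> (e, f) \<in> poly_fun n"
| cong: "(d, f) \<in> poly_fun n \<Longrightarrow> (\<And>x. x \<in> carrier_vec n \<Longrightarrow> g x = f x) \<Longrightarrow> (d, g) \<in> poly_fun n"

lemma poly_fun_sum:
  "(\<And>a. a \<in> I \<Longrightarrow> (d, F a) \<in> poly_fun n) \<Longrightarrow> (d, \<lambda>x. \<Sum>a\<in>I. F a x) \<in> poly_fun n"
  by (induction I rule: infinite_finite_induct)
    (auto intro: poly_fun.add poly_fun.mono[OF poly_fun.const])

lemma poly_fun_mult_mat_vec:
  assumes A: "A \<in> carrier_mat n n" and f: "(d, f) \<in> poly_fun n"
  shows "(d, \<lambda>x. f (A *\<^sub>v x)) \<in> poly_fun n"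
  using f
proof induction
  case (coordinate i)
  have c: "(1, \<lambda>x. A $$ (i, j) * x $ j) \<in> poly_fun n" if "j < n" for j
    using poly_fun.mult[OF poly_fun.const[of "A $$ (i, j)"] poly_fun.coordinate[OF that]] by simp
  have "(1, \<lambda>x. \<Sum>j<n. A $$ (i, j) * x $ j) \<in> poly_fun n"
    by (intro poly_fun_sum c) simp
  moreover have "(A *\<^sub>v x) $ i = (\<Sum>j<n. A $$ (i, j) * x $ j)" if "x \<in> carrier_vec n" for x
    using A that coordinate by (auto simp: scalar_prod_def atLeast0LessThan)
  ultimately show ?case by (rule poly_fun.cong)
next
  case (cong d f g)
  show ?case by (rule poly_fun.cong[OF cong(3)]) (use A cong(2) in auto)
next
  case (mono d f e)
  show ?case by (rule poly_fun.mono[OF mono.IH mono.hyps(2)])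
qed (auto intro: poly_fun.const poly_fun.add poly_fun.mult)

lemma poly_fun_eval:
  "(d, f) \<in> poly_fun n \<Longrightarrow>
    \<exists>F\<in>polys n. degree_at_most d F \<and> (\<forall>x\<in>carrier_vec n. f x = eval x F)"
proof (induction rule: poly_fun.induct)
  case (const c)
  show ?case
    by (intro bexI[of _ "const c"]) (auto simp: eval_const degree_at_most_const polys_const)
next
  case (coordinate i)
  then show ?case
    by (intro bexI[of _ "var i"]) (auto simp: eval_var degree_at_most_var[simplified] polys_var)
next
  case (add d f g)
  then obtain F G where FG: "F \<in> polys n" "degree_at_most d F" "\<forall>x\<in>carrier_vec n. f x = eval x F"
    "G \<in> polys n" "degree_at_most d G" "\<forall>x\<in>carrier_vec n. g x = eval x G" by blast
  then show ?case
    by (intro bexI[of _ "F + G"]) (auto simp: eval_add degree_at_most_add polys_add)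
next
  case (mult d f e g)
  then obtain F G where FG: "F \<in> polys n" "degree_at_most d F" "\<forall>x\<in>carrier_vec n. f x = eval x F"
    "G \<in> polys n" "degree_at_most e G" "\<forall>x\<in>carrier_vec n. g x = eval x G" by blast
  then show ?case
    by (intro bexI[of _ "F * G"]) (auto simp: eval_mult degree_at_most_mult polys_mult)
next
  case (mono d f e)
  then show ?case using degree_at_most_mono by blast
qed auto

lemma eval_act:
  assumes "f \<in> polys n" "\<rho> (inv\<^bsub>G\<^esub> g) \<in> carrier_mat n n" "v \<in> carrier_vec n"
  shows "eval v (act G n \<rho> g f) = eval (\<rho> (inv\<^bsub>G\<^esub> g) *\<^sub>v v) f"
  unfolding act_def
proof (rule eval_subst[OF assms(1)])
  fix i assume "i < n"
  then show "eval v (\<Sum>j<n. const (\<rho> (inv\<^bsub>G\<^esub> g) $$ (i, j)) * var j) = (\<rho> (inv\<^bsub>G\<^esub> g) *\<^sub>v v) $ i"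
    using assms(2,3) by (auto simp: eval_sum eval_mult eval_const eval_var scalar_prod_def atLeast0LessThan)
qed

section \<open>Orbits and invariants of a matrix representation\<close>

locale matrix_rep = group G for G (structure) +
  fixes n :: nat and \<rho> :: "'a \<Rightarrow> 'k::field_char_0 mat"
  assumes rep: "is_rep G n \<rho>"
begin

lemma rep_carrier [simp]: "g \<in> carrier G \<Longrightarrow> \<rho> g \<in> carrier_mat n n"
  using rep by (auto simp: is_rep_def hom_def units_of_carrier Units_def ring_mat_simps Pi_iff)

lemma rep_mult: "g \<in> carrier G \<Longrightarrow> h \<in> carrier G \<Longrightarrow> \<rho> (g \<otimes> h) = \<rho> g * \<rho> h"
  using rep by (simp add: is_rep_def hom_def units_of_mult ring_mat_simps)

lemma rep_one: "\<rho> \<one> = 1\<^sub>m n"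
proof -
  let ?U = "units_of (ring_mat TYPE('k) n ())"
  interpret R: ring "ring_mat TYPE('k) n ()" by (rule ring_mat)
  have "group ?U" by (rule R.units_group)
  with rep have "\<rho> \<one> = \<one>\<^bsub>?U\<^esub>"
    unfolding is_rep_def by (intro hom_one is_group)
  then show ?thesis by (simp add: units_of_one ring_mat_simps)
qed

lemma rep_mult_vec:
  "g \<in> carrier G \<Longrightarrow> h \<in> carrier G \<Longrightarrow> v \<in> carrier_vec n \<Longrightarrow> \<rho> (g \<otimes> h) *\<^sub>v v = \<rho> g *\<^sub>v (\<rho> h *\<^sub>v v)"
  by (simp add: rep_mult assoc_mult_mat_vec[of _ n n _ n])

lemma rep_vec_carrier [simp]: "g \<in> carrier G \<Longrightarrow> v \<in> carrier_vec n \<Longrightarrow> \<rho> g *\<^sub>v v \<in> carrier_vec n"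
  by (rule mult_mat_vec_carrier[of _ n n]) auto

lemma orbit_eq:
  assumes g: "g \<in> carrier G" and v: "v \<in> carrier_vec n"
  shows "orbit G \<rho> (\<rho> g *\<^sub>v v) = orbit G \<rho> v"
proof
  show "orbit G \<rho> (\<rho> g *\<^sub>v v) \<subseteq> orbit G \<rho> v"
  proof
    fix x assume "x \<in> orbit G \<rho> (\<rho> g *\<^sub>v v)"
    then obtain h where h: "h \<in> carrier G" "x = \<rho> (h \<otimes> g) *\<^sub>v v"
      using assms by (auto simp: orbit_def rep_mult_vec)
    then show "x \<in> orbit G \<rho> v"
      using g by (auto simp: orbit_def intro!: exI[of _ "h \<otimes> g"])
  qed
  show "orbit G \<rho> v \<subseteq> orbit G \<rho> (\<rho> g *\<^sub>v v)"
  proof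
    fix x assume "x \<in> orbit G \<rho> v"
    then obtain h where h: "h \<in> carrier G" "x = \<rho> h *\<^sub>v v" by (auto simp: orbit_def)
    have "x = \<rho> (h \<otimes> inv g) *\<^sub>v (\<rho> g *\<^sub>v v)"
      using g h v by (simp add: rep_mult_vec[symmetric] m_assoc)
    then show "x \<in> orbit G \<rho> (\<rho> g *\<^sub>v v)"
      using g h by (auto simp: orbit_def intro!: exI[of _ "h \<otimes> inv g"])
  qed
qed

lemma in_orbit: "v \<in> carrier_vec n \<Longrightarrow> v \<in> orbit G \<rho> v"
  by (auto simp: orbit_def rep_one intro!: exI[of _ \<one>])

text \<open>The inverse in \<open>act\<close> disappears because g runs through the whole
  group.\<close>

lemma invariants_iff:
  assumes f: "f \<in> polys n"
  shows "f \<in> invariants G n \<rho> \<longleftrightarrow> (\<forall>g\<in>carrier G. \<forall>v\<in>carrier_vec n. eval (\<rho> g *\<^sub>v v) f = eval v f)"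
proof
  assume inv: "f \<in> invariants G n \<rho>"
  show "\<forall>g\<in>carrier G. \<forall>v\<in>carrier_vec n. eval (\<rho> g *\<^sub>v v) f = eval v f"
  proof (intro ballI)
    fix g and v :: "'k vec" assume gv: "g \<in> carrier G" "v \<in> carrier_vec n"
    have "act G n \<rho> (inv g) f = f" using inv gv by (simp add: invariants_def)
    then show "eval (\<rho> g *\<^sub>v v) f = eval v f" using eval_act[OF f, of \<rho> G "inv g" v] gv by simp
  qed
next
  assume *: "\<forall>g\<in>carrier G. \<forall>v\<in>carrier_vec n. eval (\<rho> g *\<^sub>v v) f = eval v f"
  have "act G n \<rho> g f = f" if g: "g \<in> carrier G" for g
  proof (rule eval_eq_imp_eq[OF _ f])
    show "act G n \<rho> g f \<in> polys n"
      unfolding act_def by (intro polys_subst f polys_sum polys_mult polys_const polys_var) simp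
  qed (use * g in \<open>simp add: eval_act[OF f]\<close>)
  then show "f \<in> invariants G n \<rho>" using f by (simp add: invariants_def)
qed

end

section \<open>The presented group and its representations\<close>

definition M27_relations :: "(two_gens word \<times> two_gens word) set" where
  "M27_relations = {(replicate 9 (gen_a, True), []), (replicate 3 (gen_b, True), []),
     ([(gen_b, True), (gen_a, True), (gen_b, False)], replicate 4 (gen_a, True))}"

abbreviation M27_class :: "two_gens word \<Rightarrow> two_gens word set" where
  "M27_class \<equiv> word_class M27_relations"

lemma M27_eq: "M27 = presented_group M27_relations"
  by (simp add: M27_def M27_relations_def Let_def)

lemma M27_group: "group M27"
  by (simp add: M27_eq group_presented_group)

lemma M27_carrier: "carrier M27 = range M27_class"
  by (simp add: M27_eq presented_group_carrier)

lemma M27_one: "\<one>\<^bsub>M27\<^esub> = M27_class []"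
  by (simp add: M27_eq presented_group_one)

lemma M27_mult: "M27_class u \<otimes>\<^bsub>M27\<^esub> M27_class v = M27_class (u @ v)"
  by (simp add: M27_eq presented_group_mult)

lemma word_class_eq_iff: "word_class R u = word_class R v \<longleftrightarrow> word_equiv R u v"
  unfolding word_class_def
  by (auto intro: word_equiv.refl word_equiv.sym word_equiv.trans)

lemma M27_class_a: "M27_class (replicate 9 (gen_a, True)) = M27_class []"
  and M27_class_b: "M27_class (replicate 3 (gen_b, True)) = M27_class []"
  unfolding word_class_eq_iff by (rule word_equiv.relation; simp add: M27_relations_def)+

text \<open>The third relation multiplied by b on the right, which removes the inverse letter and
  matches the form used in \<open>m27_action\<close>.\<close>

lemma M27_class_ba:
  "M27_class [(gen_b, True), (gen_a, True)] = M27_class (replicate 4 (gen_a, True) @ [(gen_b, True)])"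
proof -
  let ?R = M27_relations and ?a = "(gen_a, True)" and ?b = "(gen_b, True)" and ?b' = "(gen_b, False)"
  have "word_equiv ?R [?b', ?b] []" using word_equiv.cancel[of ?R gen_b False] by simp
  from word_equiv.append[OF word_equiv.refl[of ?R "[?b, ?a]"] this]
  have "word_equiv ?R [?b, ?a, ?b', ?b] [?b, ?a]" by simp
  moreover have "word_equiv ?R [?b, ?a, ?b'] (replicate 4 ?a)"
    by (rule word_equiv.relation) (simp add: M27_relations_def)
  from word_equiv.append[OF this word_equiv.refl[of ?R "[?b]"]]
  have "word_equiv ?R [?b, ?a, ?b', ?b] (replicate 4 ?a @ [?b])" by simp
  ultimately show ?thesis
    unfolding word_class_eq_iff by (blast intro: word_equiv.sym word_equiv.trans)
qed

locale M27_rep = matrix_rep M27 n \<rho> for n and \<rho> :: "two_gens word set \<Rightarrow> 'k::field_char_0 mat"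
begin

definition A :: "'k vec \<Rightarrow> 'k vec" where "A v = \<rho> (M27_class [(gen_a, True)]) *\<^sub>v v"
definition B :: "'k vec \<Rightarrow> 'k vec" where "B v = \<rho> (M27_class [(gen_b, True)]) *\<^sub>v v"

lemma class_carrier [simp]: "M27_class u \<in> carrier M27"
  by (simp add: M27_carrier)

lemma rep_append:
  "v \<in> carrier_vec n \<Longrightarrow> \<rho> (M27_class (u @ u')) *\<^sub>v v = \<rho> (M27_class u) *\<^sub>v (\<rho> (M27_class u') *\<^sub>v v)"
  using rep_mult_vec[of "M27_class u" "M27_class u'"] by (simp add: M27_mult)

lemma rep_Nil: "v \<in> carrier_vec n \<Longrightarrow> \<rho> (M27_class []) *\<^sub>v v = v"
  using rep_one by (simp add: M27_one)

lemma A_carrier [simp]: "v \<in> carrier_vec n \<Longrightarrow> A v \<in> carrier_vec n"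
  and B_carrier [simp]: "v \<in> carrier_vec n \<Longrightarrow> B v \<in> carrier_vec n"
  by (simp_all add: A_def B_def)

lemma A_pow: "v \<in> carrier_vec n \<Longrightarrow> \<rho> (M27_class (replicate k (gen_a, True))) *\<^sub>v v = (A ^^ k) v"
proof (induction k)
  case (Suc k)
  then show ?case using rep_append[of v "[(gen_a, True)]" "replicate k (gen_a, True)"] by (simp add: A_def)
qed (simp add: rep_Nil)

lemma B_pow: "v \<in> carrier_vec n \<Longrightarrow> \<rho> (M27_class (replicate k (gen_b, True))) *\<^sub>v v = (B ^^ k) v"
proof (induction k)
  case (Suc k)
  then show ?case using rep_append[of v "[(gen_b, True)]" "replicate k (gen_b, True)"] by (simp add: B_def)
qed (simp add: rep_Nil)

text \<open>Induction on words. An inverse letter is undone by its generator, which preserves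
  f.\<close>

lemma invariant_function:
  assumes A: "\<And>x. x \<in> carrier_vec n \<Longrightarrow> f (A x) = f x" and B: "\<And>x. x \<in> carrier_vec n \<Longrightarrow> f (B x) = f x"
    and "g \<in> carrier M27" "v \<in> carrier_vec n"
  shows "f (\<rho> g *\<^sub>v v) = f v"
proof -
  have "f (\<rho> (M27_class u) *\<^sub>v v) = f v" for u
  proof (induction u)
    case Nil
    then show ?case using assms(4) by (simp add: rep_Nil)
  next
    case (Cons l u)
    let ?x = "\<rho> (M27_class u) *\<^sub>v v"
    have x: "?x \<in> carrier_vec n" using assms(4) by simp
    have l: "\<rho> (M27_class (l # u)) *\<^sub>v v = \<rho> (M27_class [l]) *\<^sub>v ?x"
      using rep_append[of v "[l]" u] assms(4) by simp
    obtain y s where ys: "l = (y, s)" by (cases l)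
    have gen: "f (\<rho> (M27_class [(y, True)]) *\<^sub>v x) = f x" if "x \<in> carrier_vec n" for x
      using A[OF that] B[OF that] by (cases y) (simp_all add: A_def B_def)
    have "f (\<rho> (M27_class [l]) *\<^sub>v ?x) = f ?x"
    proof (cases s)
      case True
      then show ?thesis using gen[OF x] ys by simp
    next
      case False
      let ?z = "\<rho> (M27_class [l]) *\<^sub>v ?x"
      have "M27_class [(y, True), l] = M27_class []"
        unfolding word_class_eq_iff using word_equiv.cancel[of M27_relations y True] ys False by simp
      then have "?x = \<rho> (M27_class [(y, True)]) *\<^sub>v ?z"
        using rep_append[OF x, of "[(y, True)]" "[l]"] rep_Nil[OF x] by simp
      then show ?thesis using gen[of ?z] x by simp
    qed
    with l Cons.IH show ?case by simp
  qed
  then show ?thesis using assms(3) by (auto simp: M27_carrier)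
qed

theorem degree_10_separates:
  fixes \<zeta> :: 'k
  assumes \<zeta>: "\<zeta> ^ 9 = 1" "\<And>m. 0 < m \<Longrightarrow> m < 9 \<Longrightarrow> \<zeta> ^ m \<noteq> 1"
  shows "separating_set M27 n \<rho> {f \<in> invariants M27 n \<rho>. degree_at_most 10 f}"
proof -
  interpret m27_action "carrier_vec n" A B "\<lambda>d. {f. (d, f) \<in> poly_fun n}" \<zeta>
  proof
    fix x :: "'k vec" assume x: "x \<in> carrier_vec n"
    show "(A ^^ 9) x = x" using A_pow[OF x, of 9] by (simp add: M27_class_a rep_Nil x)
    have "(B ^^ 3) x = x" using B_pow[OF x, of 3] by (simp only: M27_class_b rep_Nil[OF x])
    then show "B (B (B x)) = x" by (simp add: numeral_3_eq_3)
    have "B (A x) = \<rho> (M27_class [(gen_b, True), (gen_a, True)]) *\<^sub>v x"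
      using rep_append[OF x, of "[(gen_b, True)]" "[(gen_a, True)]"] by (simp add: A_def B_def)
    also have "\<dots> = (A ^^ 4) (B x)"
      unfolding M27_class_ba using x A_pow[of "B x" 4] rep_append[OF x] by (simp add: B_def)
    finally show "B (A x) = (A ^^ 4) (B x)" .
  next
    fix v w :: "'k vec" assume "v \<in> carrier_vec n" "w \<in> carrier_vec n"
      "\<And>u. u \<in> {f. (1, f) \<in> poly_fun n} \<Longrightarrow> u v = u w"
    then show "v = w" using poly_fun.coordinate[of _ n] by (intro eq_vecI) auto
  next
    fix f d e assume "f \<in> {f :: 'k vec \<Rightarrow> 'k. (d, f) \<in> poly_fun n}" "d \<le> (e :: nat)"
    then show "f \<in> {f. (e, f) \<in> poly_fun n}" using poly_fun.mono[of d f n e] by simp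
  qed (auto simp: \<zeta> A_def B_def intro: poly_fun.const poly_fun.add poly_fun.mult poly_fun_mult_mat_vec)
  show ?thesis unfolding separating_set_def
  proof (intro conjI ballI impI)
    fix v w :: "'k vec" assume v: "v \<in> carrier_vec n" and w: "w \<in> carrier_vec n"
      and neq: "orbit M27 \<rho> v \<noteq> orbit M27 \<rho> w"
    have same_orbit: "orbit M27 \<rho> x = orbit M27 \<rho> v" if "conn v x" for x
      using that
    proof (induction rule: rtranclp_induct)
      case (step y z)
      then have "z = A y \<or> z = B y" "y \<in> carrier_vec n" by (auto simp: step_def)
      then have "orbit M27 \<rho> z = orbit M27 \<rho> y"
        using orbit_eq[of "M27_class [(gen_a, True)]" y] orbit_eq[of "M27_class [(gen_b, True)]" y]
        by (auto simp: A_def B_def)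
      with step.IH show ?case by simp
    qed simp
    have "\<not> conn v w"
    proof
      assume "conn v w"
      from same_orbit[OF this] neq show False by simp
    qed
    then have "\<not> same_traces v w" using conn_if_same_traces v w by blast
    then obtain f where f: "f \<in> wt 10 0" "tr f v \<noteq> tr f w" by (auto simp: same_traces_def)
    have "f \<in> {f. (10, f) \<in> poly_fun n}" using f(1) by (auto simp: wt_def)
    then have "tr f \<in> {f. (10, f) \<in> poly_fun n}"
      unfolding tr_def[abs_def] by (intro P_add P_\<beta>)
    then obtain F where F: "F \<in> polys n" "degree_at_most 10 F" "\<forall>x\<in>carrier_vec n. tr f x = eval x F"
      using poly_fun_eval by blast
    have trA: "tr f (A x) = tr f x" and trB: "tr f (B x) = tr f x" if "x \<in> carrier_vec n" for x
      using tr_step[OF f(1)] that by auto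
    have "F \<in> invariants M27 n \<rho>"
      unfolding invariants_iff[OF F(1)]
      using invariant_function[of "tr f", OF trA trB] F(3) by simp
    then show "\<exists>f\<in>{f \<in> invariants M27 n \<rho>. degree_at_most 10 f}. eval v f \<noteq> eval w f"
      using F f(2) v w by (intro bexI[of _ F]) auto
  qed auto
qed

end

section \<open>A representation that needs degree 10\<close>

text \<open>Coordinate i of the image of v is c i times coordinate \<sigma> i of v. Coordinates are
  pulled back, which is why products compose in the opposite order.\<close>

definition monomial_mat :: "(nat \<Rightarrow> nat) \<Rightarrow> (nat \<Rightarrow> 'k::field) \<Rightarrow> 'k mat" where
  "monomial_mat \<sigma> c = mat 4 4 (\<lambda>(i, j). if j = \<sigma> i then c i else 0)"

lemma monomial_mat_carrier [simp]: "monomial_mat \<sigma> c \<in> carrier_mat 4 4"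
  by (simp add: monomial_mat_def)

lemma monomial_mat_vec:
  assumes "v \<in> carrier_vec 4" "i < 4" "\<sigma> i < 4"
  shows "(monomial_mat \<sigma> c *\<^sub>v v) $ i = c i * v $ \<sigma> i"
proof -
  have "(monomial_mat \<sigma> c *\<^sub>v v) $ i = (\<Sum>j<4. (if j = \<sigma> i then c i else 0) * v $ j)"
    using assms by (auto simp: monomial_mat_def scalar_prod_def atLeast0LessThan)
  also have "\<dots> = (\<Sum>j<4. if j = \<sigma> i then c i * v $ j else 0)"
    by (intro sum.cong) auto
  also have "\<dots> = c i * v $ \<sigma> i" using assms(3) by simp
  finally show ?thesis .
qed

lemma monomial_mat_mult:
  assumes "\<And>i. i < 4 \<Longrightarrow> \<sigma> i < 4"
  shows "monomial_mat \<sigma> c * monomial_mat \<tau> d = monomial_mat (\<tau> \<circ> \<sigma>) (\<lambda>i. c i * d (\<sigma> i))"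
proof (rule eq_matI)
  fix i j assume "i < dim_row (monomial_mat (\<tau> \<circ> \<sigma>) (\<lambda>i. c i * d (\<sigma> i)))"
    "j < dim_col (monomial_mat (\<tau> \<circ> \<sigma>) (\<lambda>i. c i * d (\<sigma> i)))"
  then have ij: "i < 4" "j < 4" by (simp_all add: monomial_mat_def)
  have "(monomial_mat \<sigma> c * monomial_mat \<tau> d) $$ (i, j) = (monomial_mat \<sigma> c *\<^sub>v col (monomial_mat \<tau> d) j) $ i"
    using ij by (simp add: monomial_mat_def)
  also have "\<dots> = c i * col (monomial_mat \<tau> d) j $ \<sigma> i"
    using ij assms[OF ij(1)] by (intro monomial_mat_vec) (auto simp: monomial_mat_def)
  also have "\<dots> = monomial_mat (\<tau> \<circ> \<sigma>) (\<lambda>i. c i * d (\<sigma> i)) $$ (i, j)"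
    using ij assms[OF ij(1)] by (simp add: monomial_mat_def)
  finally show "(monomial_mat \<sigma> c * monomial_mat \<tau> d) $$ (i, j) =
    monomial_mat (\<tau> \<circ> \<sigma>) (\<lambda>i. c i * d (\<sigma> i)) $$ (i, j)" .
qed (simp_all add: monomial_mat_def)

lemma monomial_mat_cong:
  "(\<And>i. i < 4 \<Longrightarrow> \<sigma> i = \<tau> i \<and> c i = d i) \<Longrightarrow> monomial_mat \<sigma> c = monomial_mat \<tau> d"
  unfolding monomial_mat_def by (rule eq_matI) auto

lemma monomial_mat_one: "monomial_mat (\<lambda>i. i) (\<lambda>_. 1) = 1\<^sub>m 4"
  unfolding monomial_mat_def by (rule eq_matI) auto

lemma less_4_cases: "(i::nat) < 4 \<Longrightarrow> i = 0 \<or> i = 1 \<or> i = 2 \<or> i = 3"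
  by linarith

definition rot :: "nat \<Rightarrow> nat" where
  "rot i = (if i = 0 then 1 else if i = 1 then 2 else if i = 2 then 0 else i)"

lemma rot_less: "i < 4 \<Longrightarrow> rot i < 4"
  by (simp add: rot_def)

locale primitive_9th_root =
  fixes \<zeta> :: "'k::field_char_0"
  assumes \<zeta>_9: "\<zeta> ^ 9 = 1" and \<zeta>_prim: "0 < m \<Longrightarrow> m < 9 \<Longrightarrow> \<zeta> ^ m \<noteq> 1"
begin

text \<open>Coordinates 0, 1, 2 carry the weights 1, 4, 7 and are permuted by b; coordinate 3
  carries the additional character.\<close>

definition coeff_a :: "nat \<Rightarrow> 'k" where
  "coeff_a i = (if i = 0 then \<zeta> else if i = 1 then \<zeta> ^ 4 else if i = 2 then \<zeta> ^ 7 else 1)"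

definition coeff_b :: "nat \<Rightarrow> 'k" where
  "coeff_b i = (if i = 3 then \<zeta> ^ 3 else 1)"

fun letter_mat :: "two_gens \<times> bool \<Rightarrow> 'k mat" where
  "letter_mat (gen_a, True) = monomial_mat (\<lambda>i. i) coeff_a"
| "letter_mat (gen_a, False) = monomial_mat (\<lambda>i. i) (\<lambda>i. coeff_a i ^ 8)"
| "letter_mat (gen_b, True) = monomial_mat rot coeff_b"
| "letter_mat (gen_b, False) = monomial_mat (rot \<circ> rot) (\<lambda>i. coeff_b i ^ 2)"

fun word_mat :: "two_gens word \<Rightarrow> 'k mat" where
  "word_mat [] = 1\<^sub>m 4"
| "word_mat (l # u) = letter_mat l * word_mat u"

lemma coeff_a_9: "coeff_a i ^ 9 = 1"
proof -
  have "(\<zeta> ^ k) ^ 9 = 1" for k using \<zeta>_9 by (metis mult.commute power_mult power_one)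
  then show ?thesis using \<zeta>_9 by (simp add: coeff_a_def del: power_mult power_mult_numeral)
qed

lemma coeff_b_3: "coeff_b i ^ 3 = 1"
  using \<zeta>_9 by (simp add: coeff_b_def flip: power_mult)

lemma rot_3: "rot (rot (rot i)) = i"
  by (simp add: rot_def)

lemma coeff_b_rot: "coeff_b (rot i) = coeff_b i"
  by (simp add: rot_def coeff_b_def)

lemma letter_mat_carrier [simp]: "letter_mat l \<in> carrier_mat 4 4"
  by (cases l rule: letter_mat.cases) simp_all

lemma word_mat_carrier [simp]: "word_mat u \<in> carrier_mat 4 4"
  by (induction u) (auto intro: mult_carrier_mat[OF letter_mat_carrier])

lemma word_mat_append: "word_mat (u @ v) = word_mat u * word_mat v"
  by (induction u)
    (auto simp: assoc_mult_mat[of _ 4 4 _ 4 _ 4] left_mult_one_mat[of _ 4 4])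

lemma letter_mat_inverse: "letter_mat (x, s) * letter_mat (x, \<not> s) = 1\<^sub>m 4"
proof (cases x; cases s)
  have "c * c ^ 8 = 1" "c ^ 8 * c = 1" if "c ^ 9 = 1" for c :: 'k
    using that by (simp_all flip: power_Suc power_Suc2)
  then have a: "coeff_a i * coeff_a i ^ 8 = 1" "coeff_a i ^ 8 * coeff_a i = 1" for i
    using coeff_a_9 by blast+
  have "c * c ^ 2 = 1" "c ^ 2 * c = 1" if "c ^ 3 = 1" for c :: 'k
    using that by (simp_all flip: power_Suc power_Suc2)
  then have b: "coeff_b i * coeff_b i ^ 2 = 1" "coeff_b i ^ 2 * coeff_b i = 1" for i
    using coeff_b_3 by blast+
  show "letter_mat (x, s) * letter_mat (x, \<not> s) = 1\<^sub>m 4" if "x = gen_a" s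
    using that by (simp add: monomial_mat_mult o_def a monomial_mat_one)
  show "letter_mat (x, s) * letter_mat (x, \<not> s) = 1\<^sub>m 4" if "x = gen_a" "\<not> s"
    using that by (simp add: monomial_mat_mult o_def a monomial_mat_one)
  show "letter_mat (x, s) * letter_mat (x, \<not> s) = 1\<^sub>m 4" if "x = gen_b" s
    using that by (simp add: monomial_mat_mult o_def b rot_less rot_3 coeff_b_rot monomial_mat_one)
  show "letter_mat (x, s) * letter_mat (x, \<not> s) = 1\<^sub>m 4" if "x = gen_b" "\<not> s"
    using that by (simp add: monomial_mat_mult o_def b rot_less rot_3 coeff_b_rot monomial_mat_one)
qed

lemma word_mat_a_pow: "word_mat (replicate k (gen_a, True)) = monomial_mat (\<lambda>i. i) (\<lambda>i. coeff_a i ^ k)"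
  by (induction k) (simp_all add: monomial_mat_one monomial_mat_mult o_def)

text \<open>The relation between a and b read off on the diagonal: multiplication by 4 sends the
  exponents 1, 4, 7 to 4, 7, 1 modulo 9.\<close>

lemma coeff_a_rot:
  assumes "i < 4"
  shows "coeff_a (rot i) = coeff_a i ^ 4"
proof -
  have "\<zeta> ^ 16 = \<zeta> ^ 9 * \<zeta> ^ 7" "\<zeta> ^ 28 = (\<zeta> ^ 9) ^ 3 * \<zeta>"
    by (simp_all flip: power_add power_mult power_Suc2)
  then have "\<zeta> ^ 16 = \<zeta> ^ 7" "\<zeta> ^ 28 = \<zeta>" using \<zeta>_9 by simp_all
  then show ?thesis
    using less_4_cases[OF assms] by (auto simp: rot_def coeff_a_def simp flip: power_mult)
qed

lemma word_mat_relations: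
  assumes "(u, v) \<in> M27_relations"
  shows "word_mat u = word_mat v"
proof -
  have "word_mat (replicate 9 (gen_a, True)) = word_mat []"
    unfolding word_mat_a_pow by (simp add: coeff_a_9 monomial_mat_one)
  moreover have "word_mat (replicate 3 (gen_b, True)) = word_mat []"
  proof -
    have c: "coeff_b i * (coeff_b i * coeff_b i) = 1" for i
      using coeff_b_3[of i] by (simp add: power3_eq_cube mult.assoc)
    have "word_mat (replicate 3 (gen_b, True)) = letter_mat (gen_b, True) * (letter_mat (gen_b, True) * letter_mat (gen_b, True))"
      by (simp add: numeral_3_eq_3 right_mult_one_mat[of _ 4 4] del: letter_mat.simps)
    also have "\<dots> = 1\<^sub>m 4"
      by (simp add: monomial_mat_mult o_def rot_less rot_3 coeff_b_rot c monomial_mat_one)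
    finally show ?thesis by simp
  qed
  moreover have "word_mat [(gen_b, True), (gen_a, True), (gen_b, False)] = word_mat (replicate 4 (gen_a, True))"
  proof -
    have c: "coeff_b i * (coeff_a (rot i) * coeff_b i ^ 2) = coeff_a (rot i)" for i
      using coeff_b_3[of i] by (simp add: power3_eq_cube power2_eq_square algebra_simps)
    have "word_mat [(gen_b, True), (gen_a, True), (gen_b, False)] =
        letter_mat (gen_b, True) * (letter_mat (gen_a, True) * letter_mat (gen_b, False))"
      by (simp add: right_mult_one_mat[of _ 4 4] del: letter_mat.simps)
    also have "\<dots> = monomial_mat (\<lambda>i. i) (\<lambda>i. coeff_a (rot i))"
      by (simp add: monomial_mat_mult o_def rot_less rot_3 coeff_b_rot c)
    also have "\<dots> = word_mat (replicate 4 (gen_a, True))"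
      unfolding word_mat_a_pow by (rule monomial_mat_cong) (simp add: coeff_a_rot)
    finally show ?thesis .
  qed
  ultimately show ?thesis using assms unfolding M27_relations_def by auto
qed

lemma word_mat_equiv: "word_equiv M27_relations u v \<Longrightarrow> word_mat u = word_mat v"
proof (induction rule: word_equiv.induct)
  case (cancel x s)
  then show ?case using letter_mat_inverse[of x s] by (simp add: right_mult_one_mat[of _ 4 4])
qed (simp_all add: word_mat_relations word_mat_append)

text \<open>Any word of the class may be evaluated, by \<open>word_mat_equiv\<close>.\<close>

definition rep4 :: "two_gens word set \<Rightarrow> 'k mat" where
  "rep4 C = word_mat (SOME u. C = M27_class u)"

lemma rep4_class: "rep4 (M27_class u) = word_mat u"
proof -
  have "M27_class u = M27_class (SOME u'. M27_class u = M27_class u')" by (rule someI) simp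
  then show ?thesis unfolding rep4_def word_class_eq_iff[of _ u] using word_mat_equiv by metis
qed

lemma is_rep_rep4: "is_rep M27 4 rep4"
proof -
  let ?R = "ring_mat TYPE('k) 4 ()"
  interpret R: ring ?R by (rule ring_mat)
  have "letter_mat l \<in> Units ?R" for l
    using letter_mat_inverse[of "fst l" "snd l"] letter_mat_inverse[of "fst l" "\<not> snd l"]
    by (auto simp: Units_def ring_mat_simps intro!: bexI[of _ "letter_mat (fst l, \<not> snd l)"])
  then have "word_mat u \<in> Units ?R" for u
    using R.Units_one_closed R.Units_m_closed by (induction u) (auto simp: ring_mat_simps)
  then show ?thesis
    unfolding is_rep_def
    by (intro homI) (auto simp: M27_carrier M27_mult rep4_class word_mat_append units_of_carrier units_of_mult ring_mat_simps)
qed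

sublocale M27_rep 4 rep4
  by (intro M27_rep.intro matrix_rep.intro M27_group matrix_rep_axioms.intro is_rep_rep4)

lemma A_nth:
  assumes "x \<in> carrier_vec 4" "i < 4"
  shows "A x $ i = coeff_a i * x $ i"
proof -
  have "A x = monomial_mat (\<lambda>i. i) coeff_a *\<^sub>v x"
    by (simp add: A_def rep4_class right_mult_one_mat[of _ 4 4])
  then show ?thesis using monomial_mat_vec[OF assms, of "\<lambda>i. i"] assms by simp
qed

lemma B_nth:
  assumes "x \<in> carrier_vec 4" "i < 4"
  shows "B x $ i = coeff_b i * x $ rot i"
proof -
  have "B x = monomial_mat rot coeff_b *\<^sub>v x"
    by (simp add: B_def rep4_class right_mult_one_mat[of _ 4 4])
  then show ?thesis using monomial_mat_vec[OF assms, of rot] rot_less[OF assms(2)] by simp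
qed

section \<open>Two points that degree 9 cannot separate\<close>

definition line :: "'k \<Rightarrow> 'k \<Rightarrow> 'k vec" where
  "line t s = vec 4 (\<lambda>i. if i = 0 then t else if i = 3 then s else 0)"

lemma line_carrier [simp]: "line t s \<in> carrier_vec 4"
  by (simp add: line_def)

lemma A_pow_line: "(A ^^ k) (line t s) = line (\<zeta> ^ k * t) s"
proof (induction k)
  case (Suc k)
  have "A (line r s) = line (\<zeta> * r) s" for r
  proof (rule eq_vecI)
    fix i assume "i < dim_vec (line (\<zeta> * r) s)"
    then have "i < 4" by (simp add: line_def)
    then show "A (line r s) $ i = line (\<zeta> * r) s $ i"
      using less_4_cases[OF \<open>i < 4\<close>] by (auto simp: A_nth line_def coeff_a_def)
  qed (metis A_carrier carrier_vecD line_carrier)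
  then show ?case using Suc by (simp add: mult.assoc)
qed simp

lemma B_line: "B (line 0 s) = line 0 (\<zeta> ^ 3 * s)"
proof (rule eq_vecI)
  fix i assume "i < dim_vec (line 0 (\<zeta> ^ 3 * s))"
  then have "i < 4" by (simp add: line_def)
  then show "B (line 0 s) $ i = line 0 (\<zeta> ^ 3 * s) $ i"
    using less_4_cases[OF \<open>i < 4\<close>] by (auto simp: B_nth line_def coeff_b_def rot_def)
qed (metis B_carrier carrier_vecD line_carrier)

lemma orbits_differ: "orbit M27 rep4 (line 1 1) \<noteq> orbit M27 rep4 (line 1 (\<zeta> ^ 3))"
proof
  \<comment> \<open>A relative invariant of b in the ninth powers, compensated by coordinate 3. Its
    values at the two points are 1 and \<zeta>^3.\<close>
  define F where "F x = x $ 3 * ((x $ 0) ^ 9 + \<zeta> ^ 3 * (x $ 1) ^ 9 + \<zeta> ^ 6 * (x $ 2) ^ 9)" for x :: "'k vec"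
  have FA: "F (A x) = F x" if x: "x \<in> carrier_vec 4" for x
    by (simp add: F_def A_nth[OF x] power_mult_distrib coeff_a_9) (simp add: coeff_a_def)
  have FB: "F (B x) = F x" if x: "x \<in> carrier_vec 4" for x
  proof -
    have "F (B x) = \<zeta> ^ 3 * x $ 3 * ((x $ 1) ^ 9 + \<zeta> ^ 3 * (x $ 2) ^ 9 + \<zeta> ^ 6 * (x $ 0) ^ 9)"
      by (simp add: F_def B_nth[OF x] coeff_b_def rot_def)
    also have "\<dots> = x $ 3 * (\<zeta> ^ 3 * (x $ 1) ^ 9 + (\<zeta> ^ 3 * \<zeta> ^ 3) * (x $ 2) ^ 9 + (\<zeta> ^ 3 * \<zeta> ^ 6) * (x $ 0) ^ 9)"
      by (simp add: algebra_simps)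
    also have "\<dots> = F x" using \<zeta>_9 by (simp add: F_def flip: power_add)
    finally show ?thesis .
  qed
  assume "orbit M27 rep4 (line 1 1) = orbit M27 rep4 (line 1 (\<zeta> ^ 3))"
  then have "line 1 (\<zeta> ^ 3) \<in> orbit M27 rep4 (line 1 1)" using in_orbit[of "line 1 (\<zeta> ^ 3)"] by simp
  then obtain g where g: "g \<in> carrier M27" "line 1 (\<zeta> ^ 3) = rep4 g *\<^sub>v line 1 1"
    by (auto simp: orbit_def)
  have "F (line 1 (\<zeta> ^ 3)) = F (line 1 1)"
    unfolding g(2) using invariant_function[of F, OF FA FB g(1)] by simp
  then show False using \<zeta>_prim[of 3] by (simp add: F_def line_def)
qed

text \<open>Averaging over the powers of a leaves only the monomials whose exponent of coordinate 0
  is 0 or 9. The first kind is the value at (0, 0, 0, s), where b identifies s = 1 with s =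
  \<zeta>^3; the second kind has no room for s in degree 9.\<close>

lemma low_degree_invariants_agree:
  assumes f: "f \<in> invariants M27 4 rep4" and deg: "degree_at_most 9 f"
  shows "eval (line 1 1) f = eval (line 1 (\<zeta> ^ 3)) f"
proof -
  have fp: "f \<in> polys 4" using f by (simp add: invariants_def)
  have inv: "eval (rep4 g *\<^sub>v x) f = eval x f" if "g \<in> carrier M27" "x \<in> carrier_vec 4" for g x
    using f that unfolding invariants_iff[OF fp] by blast
  have A: "eval (line (\<zeta> ^ k) s) f = eval (line 1 s) f" for k s
    using inv[of "M27_class (replicate k (gen_a, True))" "line 1 s"] by (simp add: A_pow A_pow_line)
  have B: "eval (line 0 (\<zeta> ^ 3)) f = eval (line 0 1) f"
    using inv[of "M27_class [(gen_b, True)]" "line 0 1"] B_line[of 1] by (simp add: B_def)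
  let ?l = Poly_Mapping.lookup
  \<comment> \<open>Since 0^0 = 1, this factor keeps exactly the monomials free of coordinates 1 and
    2.\<close>
  let ?y = "\<lambda>s m. 0 ^ ?l m 1 * 0 ^ ?l m 2 * s ^ ?l m 3 :: 'k"
  have keys: "Poly_Mapping.keys m \<subseteq> {..<4}" if "m \<in> Poly_Mapping.keys f" for m
    using fp that by (auto simp: polys_def)
  have ev: "eval (line t s) f = (\<Sum>m\<in>Poly_Mapping.keys f. ?l f m * (t ^ ?l m 0 * ?y s m))" for t s
    unfolding eval_superset[OF finite_keys order_refl]
    using keys by (intro sum.cong)
      (auto simp: monomial_value_superset[of "{..<4}"] line_def eval_nat_numeral lessThan_Suc algebra_simps)
  \<comment> \<open>Subtracting the value at t = 0 removes the monomials in which coordinate 0 does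
    not occur.\<close>
  have diff: "9 * eval (line 1 s) f - 9 * eval (line 0 s) f =
      (\<Sum>m\<in>Poly_Mapping.keys f. ?l f m * (((\<Sum>k<9. (\<zeta> ^ k) ^ ?l m 0) - 9 * 0 ^ ?l m 0) * ?y s m))" for s
  proof -
    have "9 * eval (line 1 s) f = (\<Sum>k<9. eval (line (\<zeta> ^ k) s) f)" by (simp add: A)
    also have "\<dots> = (\<Sum>m\<in>Poly_Mapping.keys f. \<Sum>k<9. ?l f m * ((\<zeta> ^ k) ^ ?l m 0 * ?y s m))"
      unfolding ev by (rule sum.swap)
    also have "\<dots> = (\<Sum>m\<in>Poly_Mapping.keys f. ?l f m * ((\<Sum>k<9. (\<zeta> ^ k) ^ ?l m 0) * ?y s m))"
      by (simp only: sum_distrib_left sum_distrib_right)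
    finally show ?thesis
      unfolding ev[of 0] by (simp add: sum_distrib_left algebra_simps flip: sum_subtractf)
  qed
  have term_eq: "((\<Sum>k<9. (\<zeta> ^ k) ^ ?l m 0) - 9 * 0 ^ ?l m 0) * ?y 1 m =
      ((\<Sum>k<9. (\<zeta> ^ k) ^ ?l m 0) - 9 * 0 ^ ?l m 0) * ?y (\<zeta> ^ 3) m"
    if m: "m \<in> Poly_Mapping.keys f" for m
  proof -
    have "monomial_degree m \<le> 9" using deg m by (simp add: degree_at_most_iff)
    then have d: "?l m 0 + ?l m 1 + ?l m 2 + ?l m 3 \<le> 9"
      using keys[OF m] by (simp add: monomial_degree_superset[of "{..<4}"] eval_nat_numeral lessThan_Suc)
    consider "?l m 0 = 0" | "?l m 0 = 9" | "0 < ?l m 0" "?l m 0 < 9" using d by linarith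
    then show ?thesis
    proof cases
      case 1
      then show ?thesis by simp
    next
      case 2
      \<comment> \<open>Coordinate 0 uses up the whole degree; degree 10 would leave room for one
        factor s.\<close>
      then have "?l m 3 = 0" using d by simp
      then show ?thesis by simp
    next
      case 3
      let ?z = "\<zeta> ^ ?l m 0"
      have "?z \<noteq> 1" using \<zeta>_prim 3 by blast
      moreover have "?z ^ 9 = 1" using \<zeta>_9 by (metis mult.commute power_mult power_one)
      then have "(1 - ?z) * (\<Sum>k<9. ?z ^ k) = 0" using one_diff_power_eq[of ?z 9] by simp
      ultimately have "(\<Sum>k<9. ?z ^ k) = 0" by simp
      moreover have "(\<zeta> ^ k) ^ ?l m 0 = ?z ^ k" for k by (simp add: mult.commute flip: power_mult)
      ultimately show ?thesis using 3 by simp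
    qed
  qed
  have "9 * eval (line 1 1) f - 9 * eval (line 0 1) f =
      9 * eval (line 1 (\<zeta> ^ 3)) f - 9 * eval (line 0 (\<zeta> ^ 3)) f"
    unfolding diff by (rule sum.cong) (simp_all only: term_eq)
  then have "9 * eval (line 1 1) f = 9 * eval (line 1 (\<zeta> ^ 3)) f" by (simp add: B)
  then show ?thesis by (subst (asm) mult_cancel_left) simp
qed

lemma beta_sep_rep4: "10 \<le> beta_sep_rep M27 4 rep4"
  unfolding beta_sep_rep_def
proof (rule Inf_greatest)
  fix x assume "x \<in> {enat d |d. d > 0 \<and> separating_set M27 4 rep4 {f \<in> invariants M27 4 rep4. degree_at_most d f}}"
  then obtain d where d: "x = enat d" "separating_set M27 4 rep4 {f \<in> invariants M27 4 rep4. degree_at_most d f}"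
    by blast
  obtain f where f: "f \<in> invariants M27 4 rep4" "degree_at_most d f"
    "eval (line 1 1) f \<noteq> eval (line 1 (\<zeta> ^ 3)) f"
    using d(2) orbits_differ line_carrier unfolding separating_set_def by blast
  have "\<not> d \<le> 9" using low_degree_invariants_agree[OF f(1)] degree_at_most_mono[OF f(2)] f(3) by blast
  then show "10 \<le> x" unfolding d(1) numeral_eq_enat by simp
qed

end

theorem theorem7p4:
  fixes \<zeta> :: "'k::field_char_0"
  assumes "\<zeta> ^ 9 = 1" and "\<And>m. 0 < m \<Longrightarrow> m < 9 \<Longrightarrow> \<zeta> ^ m \<noteq> 1"
  shows "beta_sep TYPE('k) M27 = 10"
  unfolding beta_sep_def
proof (rule antisym)
  interpret primitive_9th_root \<zeta> using assms by unfold_locales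
  show "10 \<le> Sup {beta_sep_rep M27 n \<rho> |n (\<rho> :: _ \<Rightarrow> 'k mat). is_rep M27 n \<rho>}"
    using is_rep_rep4 by (intro order_trans[OF beta_sep_rep4] Sup_upper) blast
next
  show "Sup {beta_sep_rep M27 n \<rho> |n (\<rho> :: _ \<Rightarrow> 'k mat). is_rep M27 n \<rho>} \<le> 10"
  proof (rule Sup_least)
    fix x assume "x \<in> {beta_sep_rep M27 n \<rho> |n (\<rho> :: _ \<Rightarrow> 'k mat). is_rep M27 n \<rho>}"
    then obtain n and \<rho> :: "_ \<Rightarrow> 'k mat" where x: "x = beta_sep_rep M27 n \<rho>" "is_rep M27 n \<rho>" by blast
    interpret M27_rep n \<rho>
      by (intro M27_rep.intro matrix_rep.intro M27_group matrix_rep_axioms.intro x)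
    show "x \<le> 10"
      unfolding x beta_sep_rep_def numeral_eq_enat
      using degree_10_separates[OF assms] by (intro Inf_lower) auto
  qed
qed

end
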